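(* Let $\mathcal F=\{f_d\}_{d=0}^\infty$ be an admissible sequence of polynomials, $\boldsymbol{x}=(x_1,\dots,x_n)$, and let $\mu$ be a strict partition of length $\le n$. Define formal power series $b^s_r(z)$ ($r,s\ge 0$) by the relation $$f_r(u)\cdot\frac{1+uz}{1-uz}=\sum_{s=0}^\infty b^s_r(z)f_s(u),$$ and define the modified Pieri coefficients $c^\lambda_{\mu,r}$ by the relation $$P^{\mathcal F}_\mu(\boldsymbol{x})\cdot q_r(\boldsymbol{x})=\sum_\lambda c^\lambda_{\mu,r}P^{\mathcal F}_\lambda(\boldsymbol{x})\qquad(r\ge 0),$$ where the summation is over all strict partitions $\lambda$ of length $\le n$. For $\alpha=(\alpha_1,\dots,\alpha_k)$ and $\beta=(\beta_1,\dots,\beta_k)$ put $B^\alpha_\beta=\big(b^{\alpha_i}_{\beta_j}(z)\big)_{1\le i,j\le k}$. Then for every strict partition $\lambda$ of length $\le n$, $$\sum_{r=0}^\infty c^\lambda_{\mu,r}z^r=\begin{cases}\det B^\lambda_\mu&\text{if $n+l(\mu)$ is even and $l(\lambda)=l(\mu)$,}\\ \det B^{\lambda^0}_\mu&\text{if $n+l(\mu)$ is even and $l(\lambda)=l(\mu)-1$,}\\ \det B^\lambda_{\mu^0}&\text{if $n+l(\mu)$ is even and $l(\lambda)=l(\mu)+1$,}\\ \det B^{\lambda^0}_{\mu^0}&\text{if $n+l(\mu)$ is odd and $l(\lambda)=l(\mu)$,}\\ \det B^\lambda_{\mu^0}&\text{if $n+l(\mu)$ is odd and $l(\lambda)=l(\mu)+1$,}\\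 0&\text{otherwise.}\end{cases}$$
   Context: $K$ is a field of characteristic $0$. A sequence $\mathcal F=\{f_d\}_{d=0}^\infty$ of polynomials $f_d(u)\in K[u]$ is admissible if $f_0=1$ and $\deg f_d=d$ for all $d\ge 1$. A strict partition of length $l=l(\lambda)$ is a strictly decreasing sequence $\lambda=(\lambda_1>\dots>\lambda_l)$ of positive integers (the empty sequence $\emptyset$ has length $0$); put $\lambda^0=(\lambda_1,\dots,\lambda_l,0)$. ${}^tM$ denotes the transpose of $M$, $O$ a zero matrix, and $\mathrm{Pf}$ the Pfaffian. For indeterminates $\boldsymbol{x}=(x_1,\dots,x_n)$ put $A(\boldsymbol{x})=\left(\frac{x_j-x_i}{x_j+x_i}\right)_{1\le i,j\le n}$ and $\Delta(\boldsymbol{x})=\prod_{1\le i<j\le n}\frac{x_j-x_i}{x_j+x_i}$. For a sequence $\alpha=(\alpha_1,\dots,\alpha_r)$ of nonnegative integers let $V^{\mathcal F}_\alpha(\boldsymbol{x})=(f_{\alpha_j}(x_i))_{1\le i\le n,\,1\le j\le r}$. For a strict partition $\lambda$ of length $l$, the generalized $P$-function is $$P^{\mathcal F}_\lambda(\boldsymbol{x})=\frac{1}{\Delta(\boldsymbol{x})}\mathrm{Pf}\begin{pmatrix}A(\boldsymbol{x})&V^{\mathcal F}_{\lambda^*}(\boldsymbol{x})\\-{}^tV^{\mathcal F}_{\lambda^*}(\boldsymbol{x})&O\end{pmatrix},$$ where $\lambda^*=\lambda$ if $n+l$ is even and $\lambda^*=\lambda^0$ if $n+l$ is odd. The functions $P^{\mathcal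 F}_\lambda(\boldsymbol x)$, $\lambda$ strict of length $\le n$, form a $K$-basis of the ring $\Gamma^{(n)}=\{f\in K[x_1,\dots,x_n]^{S_n}: f(t,-t,x_3,\dots,x_n)\text{ is independent of }t\}$, so the coefficients $c^\lambda_{\mu,r}\in K$ are well defined. $q_r(\boldsymbol{x})=Q_{(r)}(\boldsymbol x)\in\Gamma^{(n)}$ is the Schur $Q$-function of the one-row partition $(r)$, with $q_0=1$, given by $\sum_{r\ge 0}q_r(\boldsymbol{x})z^r=\prod_{i=1}^n\frac{1+x_iz}{1-x_iz}$. The determinant of an empty ($0\times 0$) matrix is $1$. *)

theory Defs
  imports
    "HOL-Library.Poly_Mapping"
    "HOL-Computational_Algebra.Formal_Power_Series"
    "HOL-Computational_Algebra.Polynomial_Factorial"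
    "HOL-Combinatorics.Permutations"
    "Jordan_Normal_Form.Determinant"
begin

definition admissible :: "(nat \<Rightarrow> 'a::field_char_0 poly) \<Rightarrow> bool" where
  "admissible f \<longleftrightarrow> f 0 = 1 \<and> (\<forall>d\<ge>1. degree (f d) = d)"

definition strict_partition :: "nat list \<Rightarrow> bool" where
  "strict_partition lam \<longleftrightarrow> sorted_wrt (>) lam \<and> 0 \<notin> set lam"

(* The permutations p are those with p(2i) < p(2i+1) and p(0) < p(2) < p(4) < ...
   (rows and columns are numbered from 0); each perfect matching of the index set
   corresponds to exactly one of them. *)
definition pfaffian :: "'a::comm_ring_1 mat \<Rightarrow> 'a" where
  "pfaffian A =
     (if even (dim_row A) then
        (\<Sum>p\<in>{p. p permutes {0..<dim_row A} \<and>
                 (\<forall>i<dim_row A div 2. p (2*i) < p (2*i+1)) \<and>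
                 (\<forall>i j. i < j \<and> j < dim_row A div 2 \<longrightarrow> p (2*i) < p (2*j))}.
           of_int (sign p) * (\<Prod>i<dim_row A div 2. A $$ (p (2*i), p (2*i+1))))
      else 0)"

(* K(x_0, x_1, x_2, ...), the fraction field of the polynomial ring over K in countably
   many indeterminates; functions of n variables only involve x_0, ..., x_{n-1}. *)
type_synonym 'a ratfun = "((nat \<Rightarrow>\<^sub>0 nat) \<Rightarrow>\<^sub>0 'a) fract"

definition const :: "'a::field_char_0 \<Rightarrow> 'a ratfun" where
  "const c = to_fract (Poly_Mapping.single 0 c)"

definition indet :: "nat \<Rightarrow> 'a::field_char_0 ratfun" where
  "indet i = to_fract (Poly_Mapping.single (Poly_Mapping.single i 1) 1)"

definition eval_at :: "'a::field_char_0 poly \<Rightarrow> 'a ratfun \<Rightarrow> 'a ratfun" where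
  "eval_at p t = poly (map_poly const p) t"

definition A_mat :: "nat \<Rightarrow> 'a::field_char_0 ratfun mat" where
  "A_mat n = mat n n (\<lambda>(i,j). (indet j - indet i) / (indet j + indet i))"

definition Delta :: "nat \<Rightarrow> 'a::field_char_0 ratfun" where
  "Delta n = (\<Prod>(i,j)\<in>{(i,j). i < j \<and> j < n}. (indet j - indet i) / (indet j + indet i))"

definition V_mat :: "(nat \<Rightarrow> 'a::field_char_0 poly) \<Rightarrow> nat \<Rightarrow> nat list \<Rightarrow> 'a ratfun mat" where
  "V_mat f n \<alpha> = mat n (length \<alpha>) (\<lambda>(i,j). eval_at (f (\<alpha> ! j)) (indet i))"

definition append_zero :: "nat list \<Rightarrow> nat list" (\<open>_\<^sup>0\<close> [1000] 1000) where
  "lam\<^sup>0 = lam @ [0]"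

definition gen_P :: "(nat \<Rightarrow> 'a::field_char_0 poly) \<Rightarrow> nat \<Rightarrow> nat list \<Rightarrow> 'a ratfun" where
  "gen_P f n lam =
     (let lams = (if even (n + length lam) then lam else lam\<^sup>0);
          V = V_mat f n lams
      in pfaffian (four_block_mat (A_mat n) V (- transpose_mat V) (0\<^sub>m (length lams) (length lams)))
         / Delta n)"

definition schur_q :: "nat \<Rightarrow> nat \<Rightarrow> 'a::field_char_0 ratfun" where
  "schur_q n r =
     fps_nth (\<Prod>i<n. (1 + fps_const (indet i) * fps_X) / (1 - fps_const (indet i) * fps_X)) r"

(* The coefficients of g in the basis of generalized P-functions, extended by 0 to lists that
   are not strict partitions of length at most n; the support condition makes the family unique. *)
definition P_coeff ::
  "(nat \<Rightarrow> 'a::field_char_0 poly) \<Rightarrow> nat \<Rightarrow> 'a ratfun \<Rightarrow> nat list \<Rightarrow> 'a" where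
  "P_coeff f n g =
     (THE c. finite {lam. c lam \<noteq> 0} \<and>
             (\<forall>lam. c lam \<noteq> 0 \<longrightarrow> strict_partition lam \<and> length lam \<le> n) \<and>
             g = (\<Sum>lam | c lam \<noteq> 0. const (c lam) * gen_P f n lam))"

definition pieri_coeff ::
  "(nat \<Rightarrow> 'a::field_char_0 poly) \<Rightarrow> nat \<Rightarrow> nat list \<Rightarrow> nat list \<Rightarrow> nat \<Rightarrow> 'a" where
  "pieri_coeff f n lam \<mu> r = P_coeff f n (gen_P f n \<mu> * schur_q n r) lam"

definition fps_embed :: "'a::field_char_0 fps \<Rightarrow> 'a poly fract fps" where
  "fps_embed b = Abs_fps (\<lambda>k. to_fract [:fps_nth b k:])"

(* pieri_b f r s is b^s_r(z), so r is the lower index. The defining relation is an identity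
   in K(u)[[z]], with the sum over s taken in the z-adic topology. *)
definition pieri_b :: "(nat \<Rightarrow> 'a::field_char_0 poly) \<Rightarrow> nat \<Rightarrow> nat \<Rightarrow> 'a fps" where
  "pieri_b f r =
     (THE b. (\<lambda>s. fps_embed (b s) * fps_const (to_fract (f s))) sums
             (fps_const (to_fract (f r)) *
              ((1 + fps_const (to_fract [:0, 1:]) * fps_X) /
               (1 - fps_const (to_fract [:0, 1:]) * fps_X))))"

(* B_mat f \<alpha> \<beta> has upper index \<alpha> (rows) and lower index \<beta> (columns);
   it is only used when \<alpha> and \<beta> have the same length. *)
definition B_mat :: "(nat \<Rightarrow> 'a::field_char_0 poly) \<Rightarrow> nat list \<Rightarrow> nat list \<Rightarrow> 'a fps mat" where
  "B_mat f \<alpha> \<beta> = mat (length \<alpha>) (length \<beta>) (\<lambda>(i,j). pieri_b f (\<beta> ! j) (\<alpha> ! i))"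

end

theory Submission
  imports Defs
begin

text \<open>
  Multiplication by the generating series of the \<open>q_r\<close> multiplies the numerator Pfaffian of
  \<open>P_\<mu>\<close> by \<open>\<Prod>i. g(x_i)\<close>, where \<open>g(u) = (1 + u z) / (1 - u z)\<close>. Distributing one factor over
  each of the first \<open>n\<close> rows and columns replaces a bordering column \<open>f_s(x_i)\<close> by
  \<open>g(x_i) f_s(x_i) = \<Sum>t. b^t_s(z) f_t(x_i)\<close>, and it replaces the kernel
  \<open>A_ij = (x_j - x_i) / (x_j + x_i)\<close> by \<open>g(x_i) g(x_j) A_ij\<close>. The theorem rests on the identity
  \<open>g(x) g(y) (y - x) / (y + x) = (y - x) / (y + x) + g(y) - g(x)\<close> (lemma \<open>q_factor_kernel\<close>):
  the new kernel is a perturbation of the old one of rank two, spanned by the columns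
  \<open>f_0(x_i) = 1\<close> and \<open>g(x_i) f_0(x_i)\<close>.

  If \<open>n + l(\<mu>)\<close> is odd, the part \<open>0\<close> of \<open>\<mu>\<^sup>0\<close> already contributes the column \<open>g\<close>, and row
  operations with it remove the perturbation (\<open>bordered_pf_perturb_with_column\<close>). If \<open>n + l(\<mu>)\<close>
  is even, the perturbed Pfaffian is the sum of the unperturbed one and of the one bordered
  further by \<open>g\<close> and \<open>1\<close> (\<open>bordered_pf_perturb\<close>). This is why \<open>\<mu>\<close> and \<open>\<mu>\<^sup>0\<close> both occur
  in the even case and only \<open>\<mu>\<^sup>0\<close> in the odd case.

  A bordered Pfaffian is multilinear and alternating in its bordering columns. Expanding the
  columns \<open>g f_s\<close> in the columns \<open>f_t\<close> therefore yields, as in the Cauchy-Binet formula, a sum over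
  strictly decreasing sequences of a determinant of \<open>b\<close>'s times the Pfaffian of that sequence
  (\<open>q_columns_expand\<close>). A strictly decreasing sequence is either a strict partition \<open>\<lambda>\<close> or some
  \<open>\<lambda>\<^sup>0\<close>; sequences that are too long, or that contain \<open>0\<close> twice, give the Pfaffian \<open>0\<close>, and the
  other ones are numerators of \<open>P_\<lambda>\<close>. The infinite expansion causes no difficulty because up to the
  power \<open>z^r\<close> only finitely many \<open>t\<close> contribute.

  Reading off coefficients needs the linear independence of the \<open>P_\<lambda>\<close>. A relation between rational
  functions specializes to every point with positive integer coordinates, and in the last
  coordinate it becomes a polynomial identity with infinitely many roots. The coefficient in
  which the largest part of \<open>\<lambda>\<close> shows up is the same kind of relation with one variable and
  one part less (\<open>nimmo_independent\<close>).
\<close>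

section \<open>Pfaffians and simultaneous permutation of rows and columns\<close>

text \<open>
  Each perfect matching of the indices is listed once, as the permutation that orders every
  pair and sorts the pairs by their smaller elements.
\<close>

definition canon_perms :: "nat \<Rightarrow> (nat \<Rightarrow> nat) set" where
  "canon_perms N = {p. p permutes {0..<N} \<and>
                 (\<forall>i<N div 2. p (2*i) < p (2*i+1)) \<and>
                 (\<forall>i j. i < j \<and> j < N div 2 \<longrightarrow> p (2*i) < p (2*j))}"

definition pf_term :: "nat \<Rightarrow> (nat \<Rightarrow> nat \<Rightarrow> 'a::comm_ring_1) \<Rightarrow> (nat \<Rightarrow> nat) \<Rightarrow> 'a" where
  "pf_term N M p = of_int (sign p) * (\<Prod>i<N div 2. M (p (2*i)) (p (2*i+1)))"

definition pf :: "nat \<Rightarrow> (nat \<Rightarrow> nat \<Rightarrow> 'a::comm_ring_1) \<Rightarrow> 'a" where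
  "pf N M = (\<Sum>p\<in>canon_perms N. pf_term N M p)"

lemma pfaffian_eq_pf:
  assumes "even (dim_row A)"
  shows "pfaffian A = pf (dim_row A) (\<lambda>i j. A $$ (i, j))"
  using assms by (simp add: pfaffian_def pf_def pf_term_def canon_perms_def)

lemma canon_permsD:
  assumes "p \<in> canon_perms N"
  shows "p permutes {0..<N}" "\<And>i. i < N div 2 \<Longrightarrow> p (2*i) < p (2*i+1)"
    "\<And>i j. i < j \<Longrightarrow> j < N div 2 \<Longrightarrow> p (2*i) < p (2*j)"
  using assms by (auto simp: canon_perms_def)

lemma finite_canon_perms: "finite (canon_perms N)"
  by (rule finite_subset[OF _ finite_permutations[of "{0..<N}"]]) (auto simp: canon_perms_def)

lemma pf_cong:
  assumes "\<And>i j. i < j \<Longrightarrow> j < N \<Longrightarrow> M i j = M' i j"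
  shows "pf N M = pf N M'"
  unfolding pf_def
proof (rule sum.cong[OF refl])
  fix p assume p: "p \<in> canon_perms N"
  have "M (p (2*i)) (p (2*i+1)) = M' (p (2*i)) (p (2*i+1))" if "i < N div 2" for i
  proof (rule assms)
    show "p (2*i) < p (2*i+1)" using canon_permsD(2)[OF p that] .
    have "2*i+1 \<in> {0..<N}" using that by auto
    then show "p (2*i+1) < N" using permutes_in_image[OF canon_permsD(1)[OF p]] by auto
  qed
  then show "pf_term N M p = pf_term N M' p" by (simp add: pf_term_def)
qed

text \<open>
  These permutations of positions are the ones that carry the pairs \<open>{2 i, 2 i + 1}\<close> to pairs.
  Defining them by generators makes the invariance of the summands of the Pfaffian a matter of
  two kinds of generators, and the sign of a general element never has to be computed.
\<close>

inductive_set pair_perms :: "nat \<Rightarrow> (nat \<Rightarrow> nat) set" for m where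
  id: "id \<in> pair_perms m"
| flip: "h \<in> pair_perms m \<Longrightarrow> i < m \<Longrightarrow>
    h \<circ> Transposition.transpose (2*i) (2*i+1) \<in> pair_perms m"
| swap: "h \<in> pair_perms m \<Longrightarrow> i < m \<Longrightarrow> j < m \<Longrightarrow> i \<noteq> j \<Longrightarrow>
    h \<circ> (Transposition.transpose (2*i) (2*j) \<circ> Transposition.transpose (2*i+1) (2*j+1))
      \<in> pair_perms m"

lemma pair_perms_permutes:
  assumes "h \<in> pair_perms m"
  shows "h permutes {0..<2*m}"
  using assms
proof induction
  case id show ?case by (rule permutes_id)
next
  case (flip h i)
  show ?case by (rule permutes_compose[OF permutes_swap_id flip.IH]) (use flip in auto)
next
  case (swap h i j)
  show ?case
    by (rule permutes_compose[OF permutes_compose[OF permutes_swap_id permutes_swap_id] swap.IH])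
      (use swap in auto)
qed

lemma pair_perms_comp:
  assumes "h \<in> pair_perms m" "g \<in> pair_perms m"
  shows "g \<circ> h \<in> pair_perms m"
  using assms
proof induction
  case id then show ?case by simp
next
  case (flip h i)
  then show ?case using pair_perms.flip[of "g \<circ> h" m i] by (simp only: o_assoc)
next
  case (swap h i j)
  have "g \<circ> h \<in> pair_perms m" using swap by blast
  from pair_perms.swap[OF this swap.hyps(2-4)] show ?case by (simp only: o_assoc)
qed

lemma pair_perms_inv:
  assumes "h \<in> pair_perms m"
  shows "\<exists>k\<in>pair_perms m. h \<circ> k = id"
  using assms
proof induction
  case id
  show ?case by (rule bexI[of _ id]) (simp_all add: pair_perms.id)
next
  case (flip h i)
  then obtain k where k: "k \<in> pair_perms m" "h \<circ> k = id" by blast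
  let ?T = "Transposition.transpose (2*i) (2*i+1)"
  have "?T \<in> pair_perms m" using pair_perms.flip[OF pair_perms.id flip.hyps(2)] by simp
  then have "?T \<circ> k \<in> pair_perms m" by (rule pair_perms_comp[OF k(1)])
  moreover have "(h \<circ> ?T) \<circ> (?T \<circ> k) = id" using k(2) by (auto simp: fun_eq_iff)
  ultimately show ?case by blast
next
  case (swap h i j)
  then obtain k where k: "k \<in> pair_perms m" "h \<circ> k = id" by blast
  let ?T = "Transposition.transpose (2*i) (2*j) \<circ> Transposition.transpose (2*i+1) (2*j+1)"
  have "?T \<in> pair_perms m" using pair_perms.swap[OF pair_perms.id swap.hyps(2-4)] by simp
  then have "?T \<circ> k \<in> pair_perms m" by (rule pair_perms_comp[OF k(1)])
  moreover have "?T (?T x) = x" for x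
    using swap.hyps(4) by (auto simp: Transposition.transpose_def; presburger)
  then have "(h \<circ> ?T) \<circ> (?T \<circ> k) = id" using k(2) by (auto simp: fun_eq_iff)
  ultimately show ?case by blast
qed

lemma pair_perms_pairs:
  assumes "h \<in> pair_perms m" "i < m"
  shows "\<exists>j<m. h (2*i) = 2*j \<and> h (2*i+1) = 2*j+1 \<or> h (2*i) = 2*j+1 \<and> h (2*i+1) = 2*j"
  using assms
proof (induction arbitrary: i)
  case id then show ?case by auto
next
  case (flip h k)
  show ?case
  proof (cases "i = k")
    case True
    then show ?thesis using flip.IH[OF flip.prems] by auto
  next
    case False
    then have "Transposition.transpose (2*k) (2*k+1) (2*i) = 2*i"
      "Transposition.transpose (2*k) (2*k+1) (2*i+1) = 2*i+1"
      by (auto simp: Transposition.transpose_def; presburger)+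
    then show ?thesis using flip.IH[OF flip.prems] by auto
  qed
next
  case (swap h k l)
  let ?T = "Transposition.transpose (2*k) (2*l) \<circ> Transposition.transpose (2*k+1) (2*l+1)"
  let ?i = "Transposition.transpose k l i"
  have "?T (2*i) = 2 * ?i" "?T (2*i+1) = 2 * ?i + 1"
    by (auto simp: Transposition.transpose_def; presburger)+
  moreover have "?i < m" using swap by (auto simp: Transposition.transpose_def)
  ultimately show ?case using swap.IH[of ?i] by (auto simp del: comp_apply simp add: comp_def[of h])
qed

text \<open>
  The sign of the transposition is cancelled by the skew symmetry of one factor.
\<close>

lemma pf_term_flip:
  assumes alt: "\<And>a b. a < 2*m \<Longrightarrow> b < 2*m \<Longrightarrow> a \<noteq> b \<Longrightarrow> M b a = - M a b"
    and q: "q permutes {0..<2*m}" and i: "i < m"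
  shows "pf_term (2*m) M (q \<circ> Transposition.transpose (2*i) (2*i+1)) = pf_term (2*m) M q"
proof -
  let ?T = "Transposition.transpose (2*i) (2*i+1)"
  have s: "sign (q \<circ> ?T) = - sign q"
    using sign_compose[of q ?T] permutes_imp_permutation[OF _ q]
    by (simp add: permutation_swap_id sign_swap_id)
  have a: "q (2*i) < 2*m" "q (2*i+1) < 2*m"
    using permutes_in_image[OF q, of "2*i"] permutes_in_image[OF q, of "2*i+1"] i by auto
  have b: "q (2*i) \<noteq> q (2*i+1)" using inj_eq[OF permutes_inj[OF q]] by simp
  have rest: "(\<Prod>k\<in>{..<m}-{i}. M ((q \<circ> ?T) (2*k)) ((q \<circ> ?T) (2*k+1)))
     = (\<Prod>k\<in>{..<m}-{i}. M (q (2*k)) (q (2*k+1)))"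
  proof (rule prod.cong[OF refl])
    fix k assume "k \<in> {..<m}-{i}"
    then have "k \<noteq> i" by blast
    then have "?T (2*k) = 2*k" "?T (2*k+1) = 2*k+1"
      by (intro transpose_apply_other; presburger)+
    then show "M ((q \<circ> ?T) (2*k)) ((q \<circ> ?T) (2*k+1)) = M (q (2*k)) (q (2*k+1))"
      by (simp only: comp_apply)
  qed
  have "(\<Prod>k<m. M ((q \<circ> ?T) (2*k)) ((q \<circ> ?T) (2*k+1)))
      = M (q (2*i+1)) (q (2*i)) * (\<Prod>k\<in>{..<m}-{i}. M (q (2*k)) (q (2*k+1)))"
    using i by (subst prod.remove[of "{..<m}" i]) (simp_all only: rest, simp_all)
  also have "\<dots> = - (\<Prod>k<m. M (q (2*k)) (q (2*k+1)))"
    using i by (subst prod.remove[of "{..<m}" i]) (simp_all only: alt[OF a b], simp_all)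
  finally have "(\<Prod>k<m. M ((q \<circ> ?T) (2*k)) ((q \<circ> ?T) (2*k+1)))
      = - (\<Prod>k<m. M (q (2*k)) (q (2*k+1)))" .
  then show ?thesis unfolding pf_term_def s by simp
qed

text \<open>
  Exchanging two pairs is a product of two transpositions, hence even, and only reorders the
  factors.
\<close>

lemma pf_term_swap:
  assumes q: "q permutes {0..<2*m}" and i: "i < m" "j < m" "i \<noteq> j"
  shows "pf_term (2*m) M (q \<circ> (Transposition.transpose (2*i) (2*j) \<circ> Transposition.transpose (2*i+1) (2*j+1)))
    = pf_term (2*m) M q"
proof -
  let ?T1 = "Transposition.transpose (2*i) (2*j)"
  let ?T2 = "Transposition.transpose (2*i+1) (2*j+1)"
  let ?t = "Transposition.transpose i j"
  have s: "sign (q \<circ> (?T1 \<circ> ?T2)) = sign q"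
    using permutes_imp_permutation[OF _ q] i
    by (simp add: sign_compose permutation_swap_id sign_swap_id permutation_compose)
  have T: "(?T1 \<circ> ?T2) (2*k) = 2 * ?t k" "(?T1 \<circ> ?T2) (2*k+1) = 2 * ?t k + 1" for k
    by (auto simp: Transposition.transpose_def; presburger)+
  have "(\<Prod>k<m. M (q ((?T1 \<circ> ?T2) (2*k))) (q ((?T1 \<circ> ?T2) (2*k+1))))
     = (\<Prod>k<m. M (q (2 * ?t k)) (q (2 * ?t k + 1)))"
    by (simp only: T)
  also have "\<dots> = (\<Prod>k<m. M (q (2*k)) (q (2*k+1)))"
    using prod.permute[OF permutes_swap_id, of i "{..<m}" j "\<lambda>k. M (q (2*k)) (q (2*k+1))"] i
    by (simp add: comp_def)
  finally show ?thesis unfolding pf_term_def s by (simp only: comp_apply) simp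
qed

lemma pf_term_pair_perm:
  assumes alt: "\<And>a b. a < 2*m \<Longrightarrow> b < 2*m \<Longrightarrow> a \<noteq> b \<Longrightarrow> M b a = - M a b"
    and q: "q permutes {0..<2*m}" and h: "h \<in> pair_perms m"
  shows "pf_term (2*m) M (q \<circ> h) = pf_term (2*m) M q"
  using h
proof induction
  case id then show ?case by simp
next
  case (flip h i)
  have "q \<circ> h permutes {0..<2*m}"
    using permutes_compose[OF pair_perms_permutes[OF flip.hyps(1)] q] .
  from pf_term_flip[where M = M, OF _ this flip.hyps(2)] alt
  have "pf_term (2*m) M ((q \<circ> h) \<circ> Transposition.transpose (2*i) (2*i+1)) = pf_term (2*m) M (q \<circ> h)"
    by blast
  then show ?case unfolding flip.IH by (simp only: o_assoc)
next
  case (swap h i j)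
  have "q \<circ> h permutes {0..<2*m}"
    using permutes_compose[OF pair_perms_permutes[OF swap.hyps(1)] q] .
  from pf_term_swap[OF this swap.hyps(2-4), of M] show ?case unfolding swap.IH by (simp only: o_assoc)
qed

text \<open>
  Among all rearrangements of \<open>s\<close> by pair-preserving permutations, one that maximizes \<open>\<Phi>\<close> is
  canonical: orienting a wrong pair increases the second summand of the weight \<open>w\<close> and leaves
  the first one unchanged; exchanging two oriented pairs that are in the wrong order increases
  the first summand by the rearrangement inequality and leaves the second one unchanged.
\<close>

lemma canon_perm_exists:
  assumes s: "s permutes {0..<2*m}"
  shows "\<exists>h\<in>pair_perms m. s \<circ> h \<in> canon_perms (2*m)"
proof -
  define w where "w t k = k * min (t (2*k)) (t (2*k+1)) + of_bool (t (2*k) < t (2*k+1))"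
    for t :: "nat \<Rightarrow> nat" and k :: nat
  define \<Phi> where "\<Phi> t = (\<Sum>k<m. w t k)" for t
  define O' where "O' = (\<lambda>h. s \<circ> h) ` pair_perms m"
  have "pair_perms m \<subseteq> {p. p permutes {0..<2*m}}" using pair_perms_permutes by blast
  then have "finite (pair_perms m)" by (rule finite_subset[OF _ finite_permutations]) simp
  then have fin: "finite (\<Phi> ` O')" by (simp add: O'_def)
  have "\<Phi> ` O' \<noteq> {}" using pair_perms.id by (auto simp: O'_def)
  from Max_in[OF fin this] obtain h where h: "h \<in> pair_perms m"
    and max: "\<Phi> (s \<circ> h) = Max (\<Phi> ` O')" by (auto simp: O'_def)
  have le: "\<Phi> (s \<circ> g) \<le> \<Phi> (s \<circ> h)" if "g \<in> pair_perms m" for g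
    unfolding max using that fin by (auto simp: O'_def)
  define t where "t = s \<circ> h"
  have t: "t permutes {0..<2*m}" unfolding t_def
    by (rule permutes_compose[OF pair_perms_permutes[OF h] s])
  have inj: "t x = t y \<longleftrightarrow> x = y" for x y by (rule inj_eq[OF permutes_inj[OF t]])
  have orient: "t (2*i) < t (2*i+1)" if i: "i < m" for i
  proof (rule ccontr)
    assume "\<not> ?thesis"
    then have gt: "t (2*i+1) < t (2*i)" using inj[of "2*i" "2*i+1"] by linarith
    let ?T = "Transposition.transpose (2*i) (2*i+1)"
    have "w (t \<circ> ?T) k = w t k" if "k \<in> {..<m}-{i}" for k
    proof -
      have "?T (2*k) = 2*k" "?T (2*k+1) = 2*k+1"
        using that by (auto simp: Transposition.transpose_def; presburger)+
      then show ?thesis by (simp add: w_def)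
    qed
    moreover have "w (t \<circ> ?T) i = w t i + 1" using gt by (simp add: w_def min.commute)
    ultimately have "\<Phi> (t \<circ> ?T) = \<Phi> t + 1"
      using i by (simp add: \<Phi>_def sum.remove[of "{..<m}" i])
    moreover have "\<Phi> (t \<circ> ?T) \<le> \<Phi> t"
      using le[OF pair_perms.flip[OF h i]] by (simp add: t_def o_assoc)
    ultimately show False by simp
  qed
  have sorted: "t (2*i) < t (2*j)" if ij: "i < j" "j < m" for i j
  proof (rule ccontr)
    assume "\<not> ?thesis"
    then have gt: "t (2*j) < t (2*i)" using inj[of "2*i" "2*j"] ij by linarith
    let ?T = "Transposition.transpose (2*i) (2*j) \<circ> Transposition.transpose (2*i+1) (2*j+1)"
    let ?t = "Transposition.transpose i j"
    have T: "?T (2*k) = 2 * ?t k" "?T (2*k+1) = 2 * ?t k + 1" for k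
      by (auto simp: Transposition.transpose_def; presburger)+
    have w: "w t k = k * t (2*k) + 1" if "k < m" for k using orient[OF that] by (simp add: w_def)
    have w': "w (t \<circ> ?T) k = k * t (2 * ?t k) + 1" if "k < m" for k
    proof -
      have "?t k < m" using that ij by (auto simp: Transposition.transpose_def)
      from orient[OF this] show ?thesis unfolding w_def comp_apply[of t] T by simp
    qed
    have "w (t \<circ> ?T) k = w t k" if "k \<in> {..<m}-{i}-{j}" for k
      using that w'[of k] w[of k] by (simp add: Transposition.transpose_def)
    then have rest: "(\<Sum>k\<in>{..<m}-{i}-{j}. w (t \<circ> ?T) k) = (\<Sum>k\<in>{..<m}-{i}-{j}. w t k)"
      by (rule sum.cong[OF refl])
    have "i * t (2*i) + j * t (2*j) < i * t (2*j) + j * t (2*i)"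
    proof -
      obtain d where d: "j = i + d" "d > 0" using ij(1) less_imp_add_positive by blast
      show ?thesis using gt d by (simp add: algebra_simps)
    qed
    moreover have "\<Phi> u = w u i + (w u j + (\<Sum>k\<in>{..<m}-{i}-{j}. w u k))" for u
      unfolding \<Phi>_def using ij
      by (subst sum.remove[of "{..<m}" i], simp, simp, subst sum.remove[of "{..<m}-{i}" j]) auto
    ultimately have "\<Phi> t < \<Phi> (t \<circ> ?T)"
      using rest w[of i] w[of j] w'[of i] w'[of j] ij by simp
    moreover have "\<Phi> (t \<circ> ?T) \<le> \<Phi> t"
      using le[OF pair_perms.swap[OF h, of i j]] ij by (simp add: t_def o_assoc)
    ultimately show False by simp
  qed
  have "t \<in> canon_perms (2*m)" using t orient sorted by (auto simp: canon_perms_def)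
  with h show ?thesis by (auto simp: t_def)
qed

text \<open>
  Both permutations are oriented, so \<open>h\<close> permutes the pairs without flipping any; both are
  sorted, so the induced map \<open>\<pi>\<close> on pairs is strictly increasing and hence the identity.
\<close>

lemma canon_perm_unique:
  assumes c: "c \<in> canon_perms (2*m)" and c': "c \<circ> h \<in> canon_perms (2*m)"
    and h: "h \<in> pair_perms m"
  shows "h = id"
proof -
  have "\<exists>j. \<forall>i<m. j i < m \<and> h (2*i) = 2 * j i \<and> h (2*i+1) = 2 * j i + 1"
  proof (intro choice allI)
    fix i
    show "\<exists>j. i < m \<longrightarrow> j < m \<and> h (2*i) = 2 * j \<and> h (2*i+1) = 2 * j + 1"
    proof (cases "i < m")
      case True
      obtain j where j: "j < m"
        "h (2*i) = 2*j \<and> h (2*i+1) = 2*j+1 \<or> h (2*i) = 2*j+1 \<and> h (2*i+1) = 2*j"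
        using pair_perms_pairs[OF h True] by blast
      have "c (h (2*i)) < c (h (2*i+1))" using canon_permsD(2)[OF c', of i] True by simp
      moreover have "c (2*j) < c (2*j+1)" using canon_permsD(2)[OF c, of j] j by simp
      ultimately show ?thesis using j by (intro exI[of _ j]) auto
    qed simp
  qed
  then obtain \<pi> where \<pi>: "\<And>i. i < m \<Longrightarrow> \<pi> i < m \<and> h (2*i) = 2 * \<pi> i \<and> h (2*i+1) = 2 * \<pi> i + 1"
    by blast
  have mono: "\<pi> i < \<pi> j" if "i < j" "j < m" for i j
  proof (rule ccontr)
    assume "\<not> ?thesis"
    then have "c (2 * \<pi> j) \<le> c (2 * \<pi> i)"
      using canon_permsD(3)[OF c, of "\<pi> j" "\<pi> i"] \<pi>[of i] \<pi>[of j] that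
      by (cases "\<pi> j = \<pi> i") auto
    moreover have "c (h (2*i)) < c (h (2*j))" using canon_permsD(3)[OF c', of i j] that by simp
    ultimately show False using \<pi>[of i] \<pi>[of j] that by simp
  qed
  have inj: "inj_on \<pi> {..<m}"
    by (rule linorder_inj_onI) (use mono in force)+
  have "\<pi> ` {..<m} = {..<m}" by (rule endo_inj_surj[OF _ _ inj]) (use \<pi> in auto)
  then have set: "set (map \<pi> [0..<m]) = set [0..<m]" by (simp add: atLeast0LessThan)
  have "sorted_wrt (<) (map \<pi> [0..<m])"
    by (auto simp: sorted_wrt_iff_nth_less intro: mono)
  then have "map \<pi> [0..<m] = [0..<m]"
    using set by (intro strict_sorted_equal) auto
  then have \<pi>id: "\<pi> i = i" if "i < m" for i
    using that by (metis nth_map length_upt nth_upt add_0 diff_zero)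
  show "h = id"
  proof
    fix x
    show "h x = id x"
    proof (cases "x < 2*m")
      case True
      then have "x div 2 < m" by auto
      from \<pi>[OF this] \<pi>id[OF this] show ?thesis
        by (cases "even x") (auto elim!: evenE oddE)
    next
      case False
      then show ?thesis using pair_perms_permutes[OF h] by (auto simp: permutes_def)
    qed
  qed
qed

text \<open>
  The canonical permutations represent the cosets of the pair-preserving permutations, and the
  summands of the Pfaffian depend on the coset only. Composing with \<open>p\<close> permutes the cosets and
  multiplies every sign by the sign of \<open>p\<close>.
\<close>

lemma pf_permute:
  assumes alt: "\<And>a b. a < N \<Longrightarrow> b < N \<Longrightarrow> a \<noteq> b \<Longrightarrow> M b a = - M a b"
    and N: "even N" and p: "p permutes {0..<N}"
  shows "pf N (\<lambda>i j. M (p i) (p j)) = of_int (sign p) * pf N M"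
proof -
  obtain m where m: "N = 2*m" using N by blast
  note alt = alt[unfolded m] and p = p[unfolded m]
  have "\<exists>h\<in>pair_perms m. (p \<circ> c) \<circ> h \<in> canon_perms (2*m)" if "c \<in> canon_perms (2*m)" for c
    by (rule canon_perm_exists[OF permutes_compose[OF canon_permsD(1)[OF that] p]])
  then obtain h where h: "\<And>c. c \<in> canon_perms (2*m) \<Longrightarrow> h c \<in> pair_perms m"
     "\<And>c. c \<in> canon_perms (2*m) \<Longrightarrow> (p \<circ> c) \<circ> h c \<in> canon_perms (2*m)" by metis
  define r where "r c = (p \<circ> c) \<circ> h c" for c
  have inj: "inj_on r (canon_perms (2*m))"
  proof (rule inj_onI)
    fix c d assume cd: "c \<in> canon_perms (2*m)" "d \<in> canon_perms (2*m)" "r c = r d"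
    have eq: "c \<circ> h c = d \<circ> h d"
      using cd(3) inj_eq[OF permutes_inj[OF p]] by (simp add: r_def fun_eq_iff)
    obtain k where k: "k \<in> pair_perms m" "h d \<circ> k = id" using pair_perms_inv[OF h(1)[OF cd(2)]] by blast
    have "c \<circ> (h c \<circ> k) = d" using arg_cong[OF eq, of "\<lambda>f. f \<circ> k"] k(2) by (simp add: o_assoc[symmetric])
    moreover from this have "h c \<circ> k = id"
      using canon_perm_unique[OF cd(1) _ pair_perms_comp[OF k(1) h(1)[OF cd(1)]]] cd(2) by simp
    ultimately show "c = d" by simp
  qed
  have "r ` canon_perms (2*m) = canon_perms (2*m)"
    by (rule endo_inj_surj[OF finite_canon_perms _ inj]) (use h in \<open>auto simp: r_def\<close>)
  then have bij: "bij_betw r (canon_perms (2*m)) (canon_perms (2*m))" using inj by (simp add: bij_betw_def)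
  have "pf N M = (\<Sum>c\<in>canon_perms (2*m). pf_term (2*m) M (r c))"
    unfolding pf_def m using sum.reindex_bij_betw[OF bij] by metis
  also have "\<dots> = (\<Sum>c\<in>canon_perms (2*m). of_int (sign p) * pf_term (2*m) (\<lambda>i j. M (p i) (p j)) c)"
  proof (rule sum.cong[OF refl])
    fix c assume c: "c \<in> canon_perms (2*m)"
    note cp = canon_permsD(1)[OF c]
    have "pf_term (2*m) M (r c) = pf_term (2*m) M (p \<circ> c)"
      unfolding r_def by (rule pf_term_pair_perm[OF alt permutes_compose[OF cp p] h(1)[OF c]])
    also have "\<dots> = of_int (sign p) * pf_term (2*m) (\<lambda>i j. M (p i) (p j)) c"
      using permutes_imp_permutation[OF _ cp] permutes_imp_permutation[OF _ p]
      by (simp add: pf_term_def sign_compose mult.assoc)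
    finally show "pf_term (2*m) M (r c) = \<dots>" .
  qed
  also have "\<dots> = of_int (sign p) * pf N (\<lambda>i j. M (p i) (p j))"
    by (simp add: pf_def m sum_distrib_left)
  finally have *: "pf N M = of_int (sign p) * pf N (\<lambda>i j. M (p i) (p j))" .
  have "of_int (sign p) * pf N M
    = of_int (sign p * sign p) * pf N (\<lambda>i j. M (p i) (p j))"
    unfolding * by (simp only: mult.assoc of_int_mult)
  moreover have "sign p * sign p = 1" by (simp add: sign_def)
  ultimately show ?thesis by simp
qed

section \<open>Row operations on Pfaffians\<close>

definition alternating :: "nat \<Rightarrow> (nat \<Rightarrow> nat \<Rightarrow> 'a::comm_ring_1) \<Rightarrow> bool" where
  "alternating N M \<longleftrightarrow> (\<forall>i<N. M i i = 0) \<and> (\<forall>i<N. \<forall>j<N. M j i = - M i j)"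

text \<open>
  Row \<open>q\<close> becomes \<open>v\<close> and column \<open>q\<close> becomes \<open>- v\<close>, so that skew symmetry is kept off the
  diagonal.
\<close>

definition set_row :: "nat \<Rightarrow> (nat \<Rightarrow> 'a::comm_ring_1) \<Rightarrow> (nat \<Rightarrow> nat \<Rightarrow> 'a) \<Rightarrow> nat \<Rightarrow> nat \<Rightarrow> 'a" where
  "set_row q v M = (\<lambda>i j. if i = q then v j else if j = q then - v i else M i j)"

lemma alternatingD:
  assumes "alternating N M" "i < N"
  shows "M i i = 0" "j < N \<Longrightarrow> M j i = - M i j"
  using assms unfolding alternating_def by blast+

lemma alternatingI:
  assumes "\<And>i. i < N \<Longrightarrow> M i i = 0"
    and "\<And>i j. i < N \<Longrightarrow> j < N \<Longrightarrow> M j i = - M i j"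
  shows "alternating N M"
  using assms unfolding alternating_def by blast

text \<open>
  Exactly one factor of a summand involves the index \<open>q\<close>. This makes the Pfaffian linear in a
  row and the column that mirrors it.
\<close>

lemma pf_term_set_row:
  assumes N: "even N" and q: "q < N" and p: "p permutes {0..<N}"
  shows "\<exists>E a. \<forall>v. pf_term N (set_row q v M) p = E * v a"
proof -
  define k where "k = Hilbert_Choice.inv p q div 2"
  define S where "S = {..<N div 2} - {k}"
  have invq: "Hilbert_Choice.inv p q < N" using permutes_in_image[OF permutes_inv[OF p], of q] q by simp
  have k: "k < N div 2" using invq N unfolding k_def by (auto elim!: evenE)
  have ppq: "p (Hilbert_Choice.inv p q) = q" by (rule permutes_inverses(1)[OF p])
  have ki: "Hilbert_Choice.inv p q = 2*k \<or> Hilbert_Choice.inv p q = 2*k+1" unfolding k_def by presburger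
  have other: "p x \<noteq> q" if "x \<noteq> Hilbert_Choice.inv p q" for x
    using that permutes_inverses(2)[OF p, of x] by auto
  define R where "R = (\<Prod>i\<in>S. M (p (2*i)) (p (2*i+1)))"
  have split: "pf_term N (set_row q v M) p
     = of_int (sign p) * (set_row q v M (p (2*k)) (p (2*k+1)) * R)" for v
  proof -
    have "set_row q v M (p (2*i)) (p (2*i+1)) = M (p (2*i)) (p (2*i+1))" if "i \<in> S" for i
    proof -
      have "i \<noteq> k" using that by (auto simp: S_def)
      then have "2*i \<noteq> Hilbert_Choice.inv p q" "2*i+1 \<noteq> Hilbert_Choice.inv p q" using ki by presburger+
      then show ?thesis using other by (simp add: set_row_def)
    qed
    then have "(\<Prod>i\<in>S. set_row q v M (p (2*i)) (p (2*i+1))) = R"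
      unfolding R_def by (rule prod.cong[OF refl])
    then show ?thesis
      unfolding pf_term_def S_def using k by (subst prod.remove[of "{..<N div 2}" k]) auto
  qed
  from ki show ?thesis
  proof
    assume "Hilbert_Choice.inv p q = 2*k"
    then have "p (2*k) = q" using ppq by simp
    then have "pf_term N (set_row q v M) p = (of_int (sign p) * R) * v (p (2*k+1))" for v
      unfolding split by (simp add: set_row_def mult_ac)
    then show ?thesis by blast
  next
    assume *: "Hilbert_Choice.inv p q = 2*k+1"
    then have "p (2*k+1) = q" using ppq by simp
    moreover have "p (2*k) \<noteq> q" using other[of "2*k"] * by simp
    ultimately have "pf_term N (set_row q v M) p = (- (of_int (sign p) * R)) * v (p (2*k))" for v
      unfolding split by (simp add: set_row_def mult_ac)
    then show ?thesis by blast
  qed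
qed

lemma pf_set_row_sum:
  assumes N: "even N" and q: "q < N"
  shows "pf N (set_row q (\<lambda>j. \<Sum>s\<in>S. c s * v s j) M) = (\<Sum>s\<in>S. c s * pf N (set_row q (v s) M))"
proof -
  have "pf_term N (set_row q (\<lambda>j. \<Sum>s\<in>S. c s * v s j) M) p
      = (\<Sum>s\<in>S. c s * pf_term N (set_row q (v s) M) p)" if p: "p \<in> canon_perms N" for p
  proof -
    obtain E a where "\<And>v. pf_term N (set_row q v M) p = E * v a"
      using pf_term_set_row[OF N q canon_permsD(1)[OF p]] by blast
    then show ?thesis by (simp add: sum_distrib_left mult_ac)
  qed
  then show ?thesis
    unfolding pf_def by (simp add: sum_distrib_left sum.swap[of _ "canon_perms N" S])
qed

lemma pf_set_row_add:
  assumes N: "even N" and q: "q < N"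
  shows "pf N (set_row q (\<lambda>j. a j + c * b j) M) = pf N (set_row q a M) + c * pf N (set_row q b M)"
proof -
  have "pf_term N (set_row q (\<lambda>j. a j + c * b j) M) p
      = pf_term N (set_row q a M) p + c * pf_term N (set_row q b M) p" if p: "p \<in> canon_perms N" for p
  proof -
    obtain E x where "\<And>v. pf_term N (set_row q v M) p = E * v x"
      using pf_term_set_row[OF N q canon_permsD(1)[OF p]] by blast
    then show ?thesis by (simp add: algebra_simps)
  qed
  then show ?thesis unfolding pf_def by (simp add: sum_distrib_left sum.distrib)
qed

lemma pf_set_row_self:
  assumes "alternating N M" "q < N"
  shows "pf N (set_row q (M q) M) = pf N M"
proof (rule pf_cong)
  fix i j assume "i < j" "j < N"
  then show "set_row q (M q) M i j = M i j"
    using alternatingD(2)[OF assms, of i] by (auto simp: set_row_def)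
qed

text \<open>
  Exchanging the two equal rows and columns changes nothing, and changes the sign.
\<close>

lemma pf_equal_rows:
  fixes M :: "nat \<Rightarrow> nat \<Rightarrow> 'a::idom"
  assumes two: "(2::'a) \<noteq> 0" and N: "even N" and qr: "q < N" "r < N" "q \<noteq> r"
    and alt: "\<And>i j. i < N \<Longrightarrow> j < N \<Longrightarrow> i \<noteq> j \<Longrightarrow> M j i = - M i j"
    and eq: "\<And>j. j < N \<Longrightarrow> j \<noteq> q \<Longrightarrow> j \<noteq> r \<Longrightarrow> M q j = M r j" and z: "M q r = 0"
  shows "pf N M = 0"
proof -
  let ?t = "Transposition.transpose q r"
  have eq': "M j q = M j r" if j: "j < N" "j \<noteq> q" "j \<noteq> r" for j
  proof -
    have "M j q = - M q j" "M j r = - M r j" by (rule alt; use j qr in auto)+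
    then show ?thesis using eq[OF j] by simp
  qed
  have z': "M r q = 0" using alt[OF qr] z by simp
  have "pf N (\<lambda>i j. M (?t i) (?t j)) = pf N M"
  proof (rule pf_cong)
    fix i j assume ij: "i < j" "j < N"
    show "M (?t i) (?t j) = M i j"
      using ij eq[of i] eq[of j] eq'[of i] eq'[of j] z z' qr
      by (simp add: Transposition.transpose_def)
  qed
  moreover have "pf N (\<lambda>i j. M (?t i) (?t j)) = - pf N M"
    by (subst pf_permute[OF alt N permutes_swap_id]) (use qr in \<open>simp_all add: sign_swap_id\<close>)
  ultimately have "2 * pf N M = 0" by simp
  with two show ?thesis by simp
qed

lemma pf_add_row:
  fixes M :: "nat \<Rightarrow> nat \<Rightarrow> 'a::idom"
  assumes two: "(2::'a) \<noteq> 0" and N: "even N" and qr: "q < N" "r < N" "q \<noteq> r"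
    and alt: "alternating N M"
  shows "pf N (set_row q (\<lambda>j. M q j + c * M r j) M) = pf N M"
proof -
  have "pf N (set_row q (M r) M) = 0"
  proof (rule pf_equal_rows[OF two N qr])
    fix i j assume ij: "i < N" "j < N" "i \<noteq> j"
    then show "set_row q (M r) M j i = - set_row q (M r) M i j"
      using alternatingD(2)[OF alt ij(1,2)] by (simp add: set_row_def)
  qed (use qr alternatingD(1)[OF alt qr(2)] in \<open>simp_all add: set_row_def\<close>)
  then show ?thesis
    by (simp add: pf_set_row_add[OF N qr(1)] pf_set_row_self[OF alt qr(1)])
qed

text \<open>
  This is invariance under the congruence by a unipotent matrix that adds \<open>v i\<close> times row and
  column \<open>L\<close> to row and column \<open>i\<close> for all \<open>i\<close>. The rows are treated one after the other;
  \<open>w t\<close> is \<open>v\<close> cut off to the first \<open>t\<close> rows.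
\<close>

lemma pf_add_multiples_of_row:
  fixes M :: "nat \<Rightarrow> nat \<Rightarrow> 'a::idom"
  assumes two: "(2::'a) \<noteq> 0" and N: "even N" and L: "L < N" and vL: "v L = 0"
    and alt: "alternating N M"
  shows "pf N (\<lambda>i j. M i j + v i * M L j + v j * M i L) = pf N M"
proof -
  define w where "w t i = (if i < t then v i else 0)" for t i
  define W where "W t = (\<lambda>i j. M i j + w t i * M L j + w t j * M i L)" for t
  have altW: "alternating N (W t)" for t
  proof (rule alternatingI)
    fix i assume i: "i < N"
    have D: "M i i = 0" "M i L = - M L i" by (rule alternatingD[OF alt]; fact)+
    show "W t i i = 0" by (simp add: W_def D)
  next
    fix i j assume ij: "i < N" "j < N"
    have D: "M j i = - M i j" "M i L = - M L i" "M j L = - M L j"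
      by (rule alternatingD(2)[OF alt]; fact)+
    show "W t j i = - W t i j" unfolding W_def D by simp
  qed
  have step: "pf N (W (Suc t)) = pf N (W t)" if t: "t < N" for t
  proof (cases "t = L")
    case True
    then have "w (Suc t) = w t" by (auto simp: w_def fun_eq_iff vL less_Suc_eq)
    then show ?thesis by (simp add: W_def)
  next
    case False
    have WL: "W t L j = M L j" for j
      using alternatingD(1)[OF alt L] vL by (simp add: W_def w_def)
    have "pf N (W (Suc t)) = pf N (set_row t (\<lambda>j. W t t j + v t * W t L j) (W t))"
    proof (rule pf_cong)
      fix i j assume ij: "i < j" "j < N"
      have *: "w (Suc t) x = w t x" if "x \<noteq> t" for x using that by (simp add: w_def)
      have **: "w (Suc t) t = v t" "w t t = 0" by (simp_all add: w_def)
      consider "i = t" "j \<noteq> t" | "i \<noteq> t" "j = t" | "i \<noteq> t" "j \<noteq> t" using ij by force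
      then show "W (Suc t) i j = set_row t (\<lambda>j. W t t j + v t * W t L j) (W t) i j"
      proof cases
        case 1
        then show ?thesis by (simp add: set_row_def WL) (simp add: W_def * **)
      next
        case 2
        then show ?thesis
          using alternatingD(2)[OF alt, of i t] alternatingD(2)[OF alt, of L t]
            alternatingD(2)[OF alt, of L i] ij t L
          by (simp add: set_row_def WL) (simp add: W_def * ** algebra_simps)
      next
        case 3
        then show ?thesis by (simp add: set_row_def W_def *)
      qed
    qed
    also have "\<dots> = pf N (W t)" by (rule pf_add_row[OF two N t L False altW])
    finally show ?thesis .
  qed
  have all: "pf N (W t) = pf N (W 0)" if "t \<le> N" for t
    using that by (induction t) (simp_all add: step)
  have "pf N (W N) = pf N (W 0)" by (rule all[OF order.refl])
  moreover have "pf N (W N) = pf N (\<lambda>i j. M i j + v i * M L j + v j * M i L)"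
    by (rule pf_cong) (simp add: W_def w_def)
  moreover have "W 0 = M" by (simp add: W_def w_def)
  ultimately show ?thesis by simp
qed

text \<open>
  Only matchings that contain the pair \<open>{N, N + 1}\<close> contribute, and in canonical order this is
  the last pair. So no sign appears, and the remaining pairs form a canonical permutation of
  the first \<open>N\<close> indices.
\<close>

lemma pf_last_column:
  assumes N: "even N" and z: "\<And>i. i < N \<Longrightarrow> M i (N+1) = 0"
  shows "pf (N+2) M = M N (N+1) * pf N M"
proof -
  obtain m where N2: "N = 2*m" using N by blast
  have div: "(N+2) div 2 = Suc m" using N2 by simp
  let ?C = "{p \<in> canon_perms (N+2). p N = N \<and> p (N+1) = N+1}"
  have C: "?C = canon_perms N"
  proof (intro equalityI subsetI)
    fix p assume p: "p \<in> ?C"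
    then have pc: "p \<in> canon_perms (N+2)" by blast
    have "p permutes {0..<N}"
      by (rule permutes_superset[OF canon_permsD(1)[OF pc]]) (use p in \<open>auto simp: less_Suc_eq\<close>)
    then show "p \<in> canon_perms N"
      using canon_permsD(2,3)[OF pc] unfolding canon_perms_def div by (auto simp: N2)
  next
    fix p assume p: "p \<in> canon_perms N"
    note pp = canon_permsD(1)[OF p]
    have fix': "p N = N" "p (N+1) = N+1" using permutes_not_in[OF pp] by auto
    have lt: "p (2*i) < N" if "i < m" for i
      using permutes_in_image[OF pp, of "2*i"] that N2 by auto
    have "p permutes {0..<N+2}" by (rule permutes_subset[OF pp]) auto
    moreover have "p (2*i) < p (2*i+1)" if "i < Suc m" for i
      using that canon_permsD(2)[OF p, of i] fix' N2 by (auto simp: less_Suc_eq)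
    moreover have "p (2*i) < p (2*j)" if "i < j" "j < Suc m" for i j
      using that canon_permsD(3)[OF p, of i j] fix' N2 lt[of i] by (auto simp: less_Suc_eq)
    ultimately show "p \<in> ?C" unfolding canon_perms_def div using fix' by blast
  qed
  have zero: "pf_term (N+2) M p = 0" if p: "p \<in> canon_perms (N+2) - ?C" for p
  proof -
    have pc: "p \<in> canon_perms (N+2)" using p by blast
    note pp = canon_permsD(1)[OF pc]
    have less: "p x < N+2" if "x < N+2" for x using permutes_in_image[OF pp, of x] that by simp
    define x where "x = Hilbert_Choice.inv p (N+1)"
    have px: "p x = N+1" unfolding x_def by (rule permutes_inverses(1)[OF pp])
    have x: "x < N+2" using permutes_in_image[OF permutes_inv[OF pp], of "N+1"] by (simp add: x_def)
    define k where "k = x div 2"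
    have k: "k < Suc m" using x N2 by (simp add: k_def)
    have lt: "p (2*k) < p (2*k+1)" using canon_permsD(2)[OF pc] k div by metis
    have "2*k+1 < N+2" using k N2 by simp
    from less[OF this] have le: "p (2*k+1) \<le> N+1" by simp
    have "x = 2*k \<or> x = 2*k+1" unfolding k_def by presburger
    with lt le px have x2: "x = 2*k+1" by auto
    have pk: "p (2*k+1) = N+1" using px x2 by simp
    have "p (2*k) \<noteq> N"
    proof
      assume a: "p (2*k) = N"
      show False
      proof (cases "k = m")
        case True
        then show False using a pk p N2 by auto
      next
        case False
        then have "p (2*k) < p (2*m)" using canon_permsD(3)[OF pc, of k m] k div by simp
        moreover have "p (2*m) < N+2" using less[of "2*m"] N2 by simp
        ultimately have "p (2*m) = p (2*k+1)" using a pk by simp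
        then have "2*m = 2*k+1" using inj_eq[OF permutes_inj[OF pp]] by simp
        then show False by presburger
      qed
    qed
    then have "M (p (2*k)) (p (2*k+1)) = 0" using z[of "p (2*k)"] lt pk by simp
    then have "(\<Prod>i<(N+2) div 2. M (p (2*i)) (p (2*i+1))) = 0"
      using k by (subst prod.remove[of _ k]) (simp_all add: N2)
    then show ?thesis by (simp add: pf_term_def)
  qed
  have "pf (N+2) M = (\<Sum>p\<in>?C. pf_term (N+2) M p)"
    unfolding pf_def by (rule sum.mono_neutral_right[OF finite_canon_perms]) (use zero in auto)
  also have "\<dots> = (\<Sum>p\<in>canon_perms N. M N (N+1) * pf_term N M p)"
  proof (rule sum.cong[OF C])
    fix p assume "p \<in> canon_perms N"
    then have "p N = N" "p (N+1) = N+1" using C by blast+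
    then show "pf_term (N+2) M p = M N (N+1) * pf_term N M p"
      by (simp add: pf_term_def N2 mult_ac)
  qed
  finally show ?thesis by (simp add: pf_def sum_distrib_left)
qed

lemma prod_pairs: "(\<Prod>i<2*m. d i) = (\<Prod>i<m. d (2*i) * d (2*i+1 :: nat))"
  for d :: "nat \<Rightarrow> 'a::comm_monoid_mult"
  by (induction m) (simp_all add: mult_ac)

text \<open>
  Every index occurs in exactly one factor of each summand.
\<close>

lemma pf_scale:
  assumes N: "even N"
  shows "pf N (\<lambda>i j. d i * d j * M i j) = (\<Prod>i<N. d i) * pf N M"
proof -
  have "pf_term N (\<lambda>i j. d i * d j * M i j) p = (\<Prod>i<N. d i) * pf_term N M p"
    if p: "p \<in> canon_perms N" for p
  proof -
    have "(\<Prod>i<N div 2. d (p (2*i)) * d (p (2*i+1))) = (\<Prod>i<N. d (p i))"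
      using N prod_pairs[of "d \<circ> p" "N div 2"] by simp
    also have "\<dots> = (\<Prod>i<N. d i)"
      using prod.permute[of p "{..<N}" d] canon_permsD(1)[OF p] by (simp add: atLeast0LessThan comp_def)
    finally have "(\<Prod>i<N div 2. d (p (2*i)) * d (p (2*i+1))) = (\<Prod>i<N. d i)" .
    then have "(\<Prod>i<N div 2. d (p (2*i)) * d (p (2*i+1)) * M (p (2*i)) (p (2*i+1)))
        = (\<Prod>i<N. d i) * (\<Prod>i<N div 2. M (p (2*i)) (p (2*i+1)))"
      by (simp only: prod.distrib)
    then show ?thesis by (simp only: pf_term_def mult.left_commute)
  qed
  then show ?thesis by (simp add: pf_def sum_distrib_left)
qed

text \<open>
  In a nonzero summand each pair needs an index below \<open>n\<close>, but there are more than \<open>n\<close> pairs.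
\<close>

lemma pf_zero_block:
  assumes N: "even N" and n: "2*n < N"
    and z: "\<And>i j. n \<le> i \<Longrightarrow> n \<le> j \<Longrightarrow> j < N \<Longrightarrow> M i j = 0"
  shows "pf N M = 0"
  unfolding pf_def
proof (rule sum.neutral, rule ballI)
  fix p assume p: "p \<in> canon_perms N"
  note pp = canon_permsD(1)[OF p]
  have "\<exists>k<N div 2. n \<le> p (2*k)"
  proof (rule ccontr)
    assume "\<not> ?thesis"
    then have sub: "(\<lambda>k. p (2*k)) ` {..<N div 2} \<subseteq> {..<n}" by auto
    have "inj_on (\<lambda>k. p (2*k)) {..<N div 2}"
      by (rule inj_onI) (simp add: inj_eq[OF permutes_inj[OF pp]])
    from card_inj_on_le[OF this sub] have "N div 2 \<le> n" by simp
    with n N show False by (auto elim: evenE)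
  qed
  then obtain k where k: "k < N div 2" "n \<le> p (2*k)" by blast
  have "p (2*k+1) < N" using permutes_in_image[OF pp, of "2*k+1"] k N by auto
  then have "M (p (2*k)) (p (2*k+1)) = 0" using canon_permsD(2)[OF p k(1)] k by (intro z) auto
  then have "(\<Prod>i<N div 2. M (p (2*i)) (p (2*i+1))) = 0"
    using k by (subst prod.remove[of _ k]) simp_all
  then show "pf_term N M p = 0" by (simp add: pf_term_def)
qed

section \<open>Pfaffians of bordered matrices\<close>

text \<open>
  The columns are functions of the row index, so that a list of columns of any length can be
  handled without matrix dimensions.
\<close>

definition bordered ::
  "nat \<Rightarrow> (nat \<Rightarrow> nat \<Rightarrow> 'a::comm_ring_1) \<Rightarrow> (nat \<Rightarrow> 'a) list \<Rightarrow> nat \<Rightarrow> nat \<Rightarrow> 'a" where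
  "bordered n A cs = (\<lambda>i j.
     if i < n then (if j < n then A i j else (cs ! (j - n)) i)
     else (if j < n then - (cs ! (i - n)) j else 0))"

definition bordered_pf :: "nat \<Rightarrow> (nat \<Rightarrow> nat \<Rightarrow> 'a::comm_ring_1) \<Rightarrow> (nat \<Rightarrow> 'a) list \<Rightarrow> 'a" where
  "bordered_pf n A cs = pf (n + length cs) (bordered n A cs)"

lemma bordered_alternating:
  assumes "alternating n A"
  shows "alternating (n + length cs) (bordered n A cs)"
proof (rule alternatingI)
  show "bordered n A cs i i = 0" for i
    using alternatingD(1)[OF assms, of i] by (simp add: bordered_def)
  show "bordered n A cs j i = - bordered n A cs i j" for i j
    using alternatingD(2)[OF assms, of i j] by (simp add: bordered_def)
qed

lemma bordered_pf_column_sum: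
  assumes "even (n + length us + Suc (length ws))"
  shows "bordered_pf n A (us @ (\<lambda>i. \<Sum>s\<in>S. c s * v s i) # ws) = (\<Sum>s\<in>S. c s * bordered_pf n A (us @ v s # ws))"
proof -
  define N where "N = n + length us + Suc (length ws)"
  define q where "q = n + length us"
  have q: "q < N" by (simp add: N_def q_def)
  let ?M = "bordered n A (us @ (\<lambda>_. 0) # ws)"
  define r where "r w = (\<lambda>j. if j < n then - w j else 0)" for w :: "nat \<Rightarrow> 'a"
  have row: "bordered_pf n A (us @ w # ws) = pf N (set_row q (r w) ?M)" for w
    unfolding bordered_pf_def
  proof -
    have "pf N (bordered n A (us @ w # ws)) = pf N (set_row q (r w) ?M)"
      by (rule pf_cong) (auto simp: bordered_def set_row_def r_def q_def nth_append nth_Cons')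
    then show "pf (n + length (us @ w # ws)) (bordered n A (us @ w # ws)) = pf N (set_row q (r w) ?M)"
      by (simp add: N_def add.assoc)
  qed
  have "r (\<lambda>i. \<Sum>s\<in>S. c s * v s i) = (\<lambda>j. \<Sum>s\<in>S. c s * r (v s) j)"
    by (auto simp: r_def fun_eq_iff sum_negf)
  then show ?thesis
    unfolding row using pf_set_row_sum[of N q c "\<lambda>s. r (v s)" S ?M] assms q by (simp add: N_def)
qed

lemma bordered_pf_expand_columns:
  assumes "finite S" and "even (n + length us + length bs + length ws)"
  shows "bordered_pf n A (us @ map (\<lambda>b i. \<Sum>s\<in>S. b s * v s i) bs @ ws)
     = (\<Sum>xs | set xs \<subseteq> S \<and> length xs = length bs.
          (\<Prod>j<length bs. (bs ! j) (xs ! j)) * bordered_pf n A (us @ map v xs @ ws))"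
  using assms(2)
proof (induction bs arbitrary: us)
  case Nil
  have "{xs. set xs \<subseteq> S \<and> length xs = 0} = {[]}" by auto
  then show ?case by simp
next
  case (Cons b bs)
  let ?L = "{xs. set xs \<subseteq> S \<and> length xs = length bs}"
  have fin: "finite ?L" using finite_lists_length_eq[OF assms(1)] .
  have L: "{xs. set xs \<subseteq> S \<and> length xs = length (b # bs)} = (\<lambda>(s, xs). s # xs) ` (S \<times> ?L)"
    by (auto simp: length_Suc_conv image_iff)
  have inj: "inj_on (\<lambda>(s, xs). s # xs) (S \<times> ?L)" by (auto simp: inj_on_def)
  let ?W = "map (\<lambda>b i. \<Sum>s\<in>S. b s * v s i) bs @ ws"
  have "bordered_pf n A (us @ map (\<lambda>b i. \<Sum>s\<in>S. b s * v s i) (b # bs) @ ws)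
      = (\<Sum>s\<in>S. b s * bordered_pf n A (us @ v s # ?W))"
    using bordered_pf_column_sum[of n us ?W A b v S] Cons.prems by (simp add: add.assoc)
  also have "\<dots> = (\<Sum>s\<in>S. b s * (\<Sum>xs\<in>?L. (\<Prod>j<length bs. (bs ! j) (xs ! j))
                      * bordered_pf n A (us @ v s # map v xs @ ws)))"
    using Cons.IH[of "us @ [v s]" for s] Cons.prems by simp
  also have "\<dots> = (\<Sum>(s, xs)\<in>S \<times> ?L. b s * ((\<Prod>j<length bs. (bs ! j) (xs ! j))
                      * bordered_pf n A (us @ v s # map v xs @ ws)))"
    by (simp only: sum_distrib_left sum.cartesian_product)
  also have "\<dots> = (\<Sum>xs | set xs \<subseteq> S \<and> length xs = length (b # bs).
          (\<Prod>j<length (b # bs). ((b # bs) ! j) (xs ! j)) * bordered_pf n A (us @ map v xs @ ws))"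
    unfolding L by (subst sum.reindex[OF inj])
      (auto intro!: sum.cong simp: prod.lessThan_Suc_shift mult.assoc simp del: prod.lessThan_Suc)
  finally show ?case .
qed

lemma bordered_pf_permute_columns:
  assumes alt: "alternating n A" and ev: "even (n + length cs)" and p: "p permutes {..<length cs}"
  shows "bordered_pf n A (permute_list p cs) = of_int (sign p) * bordered_pf n A cs"
proof -
  define k where "k = length cs"
  define q where "q = map_permutation {..<k} ((+) n) p"
  have inj: "inj_on ((+) n) {..<k}" by simp
  have bij: "bij_betw ((+) n) {..<k} {n..<n+k}"
    by (auto simp: bij_betw_def image_iff) (metis add.commute le_add_diff_inverse less_diff_conv2 lessThan_iff)
  have q: "q permutes {n..<n+k}" unfolding q_def
    by (rule map_permutation_permutes[OF bij]) (use p in \<open>simp add: k_def\<close>)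
  have sign: "sign q = sign p" unfolding q_def
    by (rule sign_map_permutation) (use p in \<open>simp_all add: k_def\<close>)
  have q_ge: "q j = n + p (j - n)" if "n \<le> j" "j < n + k" for j
    using map_permutation_apply[OF inj, of "j - n" p] that by (simp add: q_def)
  have q_lt: "q i = i" if "i < n" for i using permutes_not_in[OF q, of i] that by simp
  have "pf (n + k) (bordered n A (permute_list p cs)) = pf (n + k) (\<lambda>i j. bordered n A cs (q i) (q j))"
  proof (rule pf_cong)
    fix i j assume ij: "i < j" "j < n + k"
    have "permute_list p cs ! (j - n) = cs ! p (j - n)" if "n \<le> j"
      using permute_list_nth[OF p] ij that by (simp add: k_def)
    then show "bordered n A (permute_list p cs) i j = bordered n A cs (q i) (q j)"
      using ij q_lt[of i] q_lt[of j] q_ge[of j] q_ge[of i]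
      by (cases "i < n"; cases "j < n") (simp_all add: bordered_def)
  qed
  also have "\<dots> = of_int (sign p) * pf (n + k) (bordered n A cs)"
    unfolding sign[symmetric]
  proof (rule pf_permute)
    show "q permutes {0..<n+k}" by (rule permutes_subset[OF q]) auto
    show "even (n + k)" using ev by (simp add: k_def)
    show "bordered n A cs b a = - bordered n A cs a b" if "a < n + k" "b < n + k" for a b
      by (rule alternatingD(2)[OF bordered_alternating[OF alt]]) (use that in \<open>simp_all add: k_def\<close>)
  qed
  finally show ?thesis by (simp add: bordered_pf_def k_def)
qed

lemma bordered_pf_repeated_column:
  fixes A :: "nat \<Rightarrow> nat \<Rightarrow> 'a::idom"
  assumes two: "(2::'a) \<noteq> 0" and alt: "alternating n A" and ev: "even (n + length cs)"
    and ab: "a < b" "b < length cs" "cs ! a = cs ! b"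
  shows "bordered_pf n A cs = 0"
  unfolding bordered_pf_def
proof (rule pf_equal_rows[OF two ev, of "n + a" "n + b"])
  show "bordered n A cs j i = - bordered n A cs i j"
    if "i < n + length cs" "j < n + length cs" for i j
    by (rule alternatingD(2)[OF bordered_alternating[OF alt]]) (use that in simp_all)
qed (use ab in \<open>auto simp: bordered_def\<close>)

lemma bordered_pf_too_many_columns:
  assumes "even (n + length cs)" and "n < length cs"
  shows "bordered_pf n A cs = 0"
  unfolding bordered_pf_def by (rule pf_zero_block[of _ n]) (use assms in \<open>auto simp: bordered_def\<close>)

lemma bordered_pf_scale:
  assumes ev: "even (n + length cs)"
  shows "(\<Prod>i<n. d i) * bordered_pf n A cs = bordered_pf n (\<lambda>i j. d i * d j * A i j) (map (\<lambda>c i. d i * c i) cs)"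
proof -
  define e where "e i = (if i < n then d i else 1)" for i
  have "(\<Prod>i<n + length cs. e i) = (\<Prod>i<n. d i)"
    by (rule prod.mono_neutral_cong_right) (auto simp: e_def)
  then have "(\<Prod>i<n. d i) * bordered_pf n A cs
     = pf (n + length cs) (\<lambda>i j. e i * e j * bordered n A cs i j)"
    unfolding bordered_pf_def by (simp add: pf_scale[OF ev])
  also have "\<dots> = bordered_pf n (\<lambda>i j. d i * d j * A i j) (map (\<lambda>c i. d i * c i) cs)"
    unfolding bordered_pf_def length_map
    by (rule pf_cong) (auto simp: bordered_def e_def)
  finally show ?thesis .
qed

text \<open>
  Subtracting the row that belongs to the column \<open>g\<close> from the first \<open>n\<close> rows changes
  the kernel by \<open>g j - g i\<close> and leaves the other columns alone, because the lower right
  block is zero.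
\<close>

lemma bordered_pf_perturb_with_column:
  fixes A :: "nat \<Rightarrow> nat \<Rightarrow> 'a::idom"
  assumes two: "(2::'a) \<noteq> 0" and alt: "alternating n A" and ev: "odd (n + length cs)"
  shows "bordered_pf n (\<lambda>i j. A i j + g j - g i) (cs @ [g]) = bordered_pf n A (cs @ [g])"
proof -
  let ?N = "n + length (cs @ [g])" and ?L = "n + length cs"
  let ?M = "bordered n A (cs @ [g])"
  define v where "v i = (if i < n then -1 else 0 :: 'a)" for i
  have "pf ?N (\<lambda>i j. ?M i j + v i * ?M ?L j + v j * ?M i ?L) = pf ?N ?M"
    by (rule pf_add_multiples_of_row[OF two]) (use ev bordered_alternating[OF alt, of "cs @ [g]"] in \<open>auto simp: v_def\<close>)
  moreover have "pf ?N (\<lambda>i j. ?M i j + v i * ?M ?L j + v j * ?M i ?L)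
      = pf ?N (bordered n (\<lambda>i j. A i j + g j - g i) (cs @ [g]))"
    by (rule pf_cong) (auto simp: bordered_def v_def nth_append)
  ultimately show ?thesis by (simp add: bordered_pf_def)
qed

text \<open>
  Consider the matrix bordered by \<open>cs\<close>, \<open>g\<close> and \<open>1\<close>, with an additional entry \<open>1\<close> in row \<open>g\<close> and
  column \<open>1\<close>; this is \<open>M\<close>. By linearity in the last row its Pfaffian is the right-hand side. On
  the other hand, subtracting the row \<open>g\<close> from the first \<open>n\<close> rows clears the last column except
  for the additional entry and perturbs the kernel, which gives the left-hand side.
\<close>

lemma bordered_pf_perturb:
  fixes A :: "nat \<Rightarrow> nat \<Rightarrow> 'a::idom"
  assumes two: "(2::'a) \<noteq> 0" and alt: "alternating n A" and ev: "even (n + length cs)"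
  shows "bordered_pf n (\<lambda>i j. A i j + g j - g i) cs = bordered_pf n A cs + bordered_pf n A (cs @ [g, \<lambda>_. 1])"
proof -
  let ?K = "n + length cs"
  let ?L = "?K + 1"
  let ?B = "bordered n A (cs @ [g, \<lambda>_. 1])"
  define e where "e j = (if j = ?K then -1 else 0 :: 'a)" for j
  define M where "M = set_row ?L (\<lambda>j. ?B ?L j + 1 * e j) ?B"
  have altB: "alternating (?K + 2) ?B"
    using bordered_alternating[OF alt, of "cs @ [g, \<lambda>_. 1]"] by (simp add: add.assoc)
  have evK: "even (?K + 2)" using ev by simp
  have M: "M i j = ?B i j + (if i = ?K \<and> j = ?L then 1 else if i = ?L \<and> j = ?K then -1 else 0)" 
    if "i < ?K + 2" "j < ?K + 2" for i j
    using that by (auto simp: M_def set_row_def e_def bordered_def nth_append)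
  have altM: "alternating (?K + 2) M"
  proof (rule alternatingI)
    fix i j assume ij: "i < ?K + 2" "j < ?K + 2"
    show "M j i = - M i j" using alternatingD(2)[OF altB ij] M[OF ij] M[OF ij(2,1)] by auto
  next
    fix i assume i: "i < ?K + 2"
    show "M i i = 0" using alternatingD(1)[OF altB i] M[OF i i] by auto
  qed
  have "pf (?K + 2) M = pf (?K + 2) ?B + pf (?K + 2) (set_row ?L e ?B)"
    unfolding M_def
    using pf_set_row_add[OF evK, of ?L "?B ?L" 1 e ?B] pf_set_row_self[OF altB, of ?L] by simp
  moreover have "pf (?K + 2) (set_row ?L e ?B) = bordered_pf n A cs"
  proof -
    have "pf (?K + 2) (set_row ?L e ?B) = set_row ?L e ?B ?K (?K + 1) * pf ?K (set_row ?L e ?B)"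
      by (rule pf_last_column[OF ev]) (auto simp: set_row_def e_def)
    also have "set_row ?L e ?B ?K (?K + 1) = 1" by (simp add: set_row_def e_def)
    also have "pf ?K (set_row ?L e ?B) = pf ?K (bordered n A cs)"
      by (rule pf_cong) (auto simp: set_row_def bordered_def nth_append)
    finally show ?thesis by (simp add: bordered_pf_def)
  qed
  moreover have "pf (?K + 2) M = bordered_pf n (\<lambda>i j. A i j + g j - g i) cs"
  proof -
    define v where "v i = (if i < n then -1 else 0 :: 'a)" for i
    let ?M' = "\<lambda>i j. M i j + v i * M ?K j + v j * M i ?K"
    have "pf (?K + 2) M = pf (?K + 2) ?M'"
      by (rule pf_add_multiples_of_row[OF two evK _ _ altM, symmetric]) (auto simp: v_def)
    also have "\<dots> = ?M' ?K (?K + 1) * pf ?K ?M'"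
      by (rule pf_last_column[OF ev]) (auto simp: M v_def bordered_def nth_append)
    also have "?M' ?K (?K + 1) = 1" by (simp add: M v_def bordered_def)
    also have "pf ?K ?M' = pf ?K (bordered n (\<lambda>i j. A i j + g j - g i) cs)"
      by (rule pf_cong) (auto simp: M v_def bordered_def nth_append)
    finally show ?thesis by (simp add: bordered_pf_def)
  qed
  ultimately show ?thesis by (simp add: bordered_pf_def add.commute add.assoc)
qed

lemma strict_decreasing_unique:
  fixes xs ys :: "nat list"
  assumes "sorted_wrt (>) xs" "sorted_wrt (>) ys" "set xs = set ys"
  shows "xs = ys"
proof -
  have "rev xs = rev ys"
    by (rule strict_sorted_equal) (use assms in \<open>auto simp: sorted_wrt_rev\<close>)
  then show ?thesis by simp
qed

lemma strict_decreasing_distinct: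
  "sorted_wrt (>) xs \<Longrightarrow> distinct (xs :: nat list)"
  by (induction xs) auto

text \<open>
  The combinatorial core of the Cauchy-Binet formula: a list without repetitions is in a unique
  way a permutation of a strictly decreasing list, and for a fixed decreasing list the sum over
  the permutations is the Leibniz formula of a determinant.
\<close>

lemma sum_lists_eq_sum_det:
  fixes F :: "nat list \<Rightarrow> 'a::comm_ring_1" and bs :: "(nat \<Rightarrow> 'a) list"
  assumes S: "finite S" and k: "length bs = k"
    and perm: "\<And>xs p. length xs = k \<Longrightarrow> p permutes {..<k} \<Longrightarrow>
      F (permute_list p xs) = of_int (sign p) * F xs"
    and rep: "\<And>xs. length xs = k \<Longrightarrow> \<not> distinct xs \<Longrightarrow> F xs = 0"
  shows "(\<Sum>xs | set xs \<subseteq> S \<and> length xs = k. (\<Prod>j<k. (bs ! j) (xs ! j)) * F xs)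
     = (\<Sum>xs | set xs \<subseteq> S \<and> length xs = k \<and> sorted_wrt (>) xs.
          det (mat k k (\<lambda>(i,j). (bs ! j) (xs ! i))) * F xs)"
proof -
  let ?L = "{xs. set xs \<subseteq> S \<and> length xs = k}"
  let ?D = "{xs. set xs \<subseteq> S \<and> length xs = k \<and> sorted_wrt (>) xs}"
  let ?P = "{p. p permutes {..<k}}"
  let ?t = "\<lambda>xs. (\<Prod>j<k. (bs ! j) (xs ! j)) * F xs"
  let ?h = "\<lambda>(xs, p). permute_list p xs"
  have finL: "finite ?L" by (rule finite_lists_length_eq[OF S])
  have inj: "inj_on ?h (?D \<times> ?P)"
  proof (rule inj_onI, clarify)
    fix xs ys :: "nat list" and p q
    assume p: "p permutes {..<length xs}" and q: "q permutes {..<length xs}"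
      and len: "length ys = length xs" and k: "k = length xs"
      and xs: "sorted_wrt (>) xs" and ys: "sorted_wrt (>) ys"
      and eq: "permute_list p xs = permute_list q ys"
    have "set xs = set ys"
      using arg_cong[OF eq, of set] p q len by (simp add: set_permute_list)
    with xs ys have xy: "xs = ys" by (rule strict_decreasing_unique)
    have "p j = q j" for j
    proof (cases "j < length xs")
      case True
      then have "xs ! p j = xs ! q j"
        using arg_cong[OF eq, of "\<lambda>l. l ! j"] xy p q by (simp add: permute_list_nth)
      moreover have "p j < length xs" "q j < length xs"
        using True permutes_in_image[OF p, of j] permutes_in_image[OF q, of j] by auto
      ultimately show ?thesis
        using nth_eq_iff_index_eq[OF strict_decreasing_distinct[OF xs]] by blast
    next
      case False
      then show ?thesis using permutes_not_in[OF p, of j] permutes_not_in[OF q, of j] by simp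
    qed
    then show "xs = ys \<and> p = q" using xy by auto
  qed
  have img: "?h ` (?D \<times> ?P) = {xs \<in> ?L. distinct xs}"
  proof (intro equalityI subsetI)
    fix ys assume "ys \<in> ?h ` (?D \<times> ?P)"
    then show "ys \<in> {xs \<in> ?L. distinct xs}"
      by (auto simp: strict_decreasing_distinct)
  next
    fix ys assume ys: "ys \<in> {xs \<in> ?L. distinct xs}"
    define xs where "xs = rev (sort ys)"
    have "sorted_wrt (<) (sort ys)" using ys by (simp add: strict_sorted_iff)
    then have "xs \<in> ?D" using ys by (simp add: xs_def sorted_wrt_rev)
    have "mset ys = mset xs" by (simp add: xs_def)
    then obtain p where "p permutes {..<length xs}" "permute_list p xs = ys"
      by (rule mset_eq_permutation)
    then show "ys \<in> ?h ` (?D \<times> ?P)" using \<open>xs \<in> ?D\<close> by force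
  qed
  have "sum ?t ?L = sum ?t {xs \<in> ?L. distinct xs}"
    by (rule sum.mono_neutral_right[OF finL]) (auto simp: rep)
  also have "\<dots> = (\<Sum>z\<in>?D \<times> ?P. ?t (?h z))"
    unfolding img[symmetric] by (subst sum.reindex[OF inj]) simp
  also have "\<dots> = (\<Sum>xs\<in>?D. \<Sum>p\<in>?P. ?t (permute_list p xs))"
    by (simp add: sum.cartesian_product case_prod_unfold)
  also have "\<dots> = (\<Sum>xs\<in>?D. det (mat k k (\<lambda>(i,j). (bs ! j) (xs ! i))) * F xs)"
  proof (rule sum.cong[OF refl])
    fix xs assume xs: "xs \<in> ?D"
    then have len: "length xs = k" by simp
    let ?B = "mat k k (\<lambda>(i,j). (bs ! j) (xs ! i))"
    have "det ?B = det (transpose_mat ?B)" by (rule det_transpose[symmetric, of _ k]) simp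
    also have "\<dots> = (\<Sum>p | p permutes {0..<k}. of_int (sign p) * (\<Prod>j=0..<k. transpose_mat ?B $$ (j, p j)))"
      by (rule det_def') simp
    also have "\<dots> = (\<Sum>p\<in>?P. of_int (sign p) * (\<Prod>j<k. (bs ! j) (xs ! p j)))"
    proof (rule sum.cong)
      fix p assume "p \<in> ?P"
      then have p: "p permutes {..<k}" by simp
      have "p j < k" if "j < k" for j using permutes_in_image[OF p, of j] that by simp
      then show "of_int (sign p) * (\<Prod>j=0..<k. transpose_mat ?B $$ (j, p j))
         = of_int (sign p) * (\<Prod>j<k. (bs ! j) (xs ! p j))"
        by (simp add: atLeast0LessThan)
    qed (simp add: atLeast0LessThan)
    finally have det: "det ?B = (\<Sum>p\<in>?P. of_int (sign p) * (\<Prod>j<k. (bs ! j) (xs ! p j)))" .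
    have "?t (permute_list p xs) = of_int (sign p) * (\<Prod>j<k. (bs ! j) (xs ! p j)) * F xs"
      if "p \<in> ?P" for p
      using that len perm[OF len, of p] by (simp add: permute_list_nth mult_ac)
    then show "(\<Sum>p\<in>?P. ?t (permute_list p xs)) = det ?B * F xs"
      unfolding det sum_distrib_right by (rule sum.cong[OF refl])
  qed
  finally show ?thesis .
qed

section \<open>Linear independence at positive integers\<close>

definition schur_kernel :: "(nat \<Rightarrow> 'a::field) \<Rightarrow> nat \<Rightarrow> nat \<Rightarrow> 'a" where
  "schur_kernel a i j = (a j - a i) / (a j + a i)"

text \<open>
  The sequence \<open>\<lambda>\<^sup>*\<close>, which makes the size of the bordered matrix even.
\<close>

definition pad :: "nat \<Rightarrow> nat list \<Rightarrow> nat list" where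
  "pad n lam = (if even (n + length lam) then lam else lam\<^sup>0)"

lemma pad_even: "even (n + length (pad n lam))"
  by (simp add: pad_def append_zero_def)

text \<open>
  The numerator of the generalized \<open>P\<close>-function at the point \<open>a\<close>. For \<open>f_d = u^d\<close> it is the
  Pfaffian in Nimmo's formula for the Schur \<open>P\<close>-functions.
\<close>

definition nimmo :: "(nat \<Rightarrow> 'a::field poly) \<Rightarrow> (nat \<Rightarrow> 'a) \<Rightarrow> nat \<Rightarrow> nat list \<Rightarrow> 'a" where
  "nimmo f a n \<alpha> = bordered_pf n (schur_kernel a) (map (\<lambda>s i. poly (f s) (a i)) \<alpha>)"

lemma schur_kernel_alternating: "alternating n (schur_kernel a)"
proof (rule alternatingI)
  show "schur_kernel a i i = 0" for i by (simp add: schur_kernel_def)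
  show "schur_kernel a j i = - schur_kernel a i j" for i j
    by (simp add: schur_kernel_def minus_divide_left add.commute)
qed

text \<open>
  Row \<open>n\<close> of the bordered matrix, as a function of the coordinate \<open>u\<close> with index \<open>n\<close>, multiplied by
  the common denominator \<open>\<Prod>i<n. (a i + u)\<close>. The value of \<open>a n\<close> does not enter. Since the Pfaffian
  is linear in that row, its coefficients as a polynomial in \<open>u\<close> are again Pfaffians, namely
  those defined next.
\<close>

definition last_row :: "(nat \<Rightarrow> 'a::field poly) \<Rightarrow> (nat \<Rightarrow> 'a) \<Rightarrow> nat \<Rightarrow> nat list \<Rightarrow> nat \<Rightarrow> 'a poly" where
  "last_row f a n \<alpha> j =
     (if j < n then [:a j, -1:] * (\<Prod>i\<in>{..<n} - {j}. [:a i, 1:])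
      else if n < j \<and> j < Suc n + length \<alpha> then (\<Prod>i<n. [:a i, 1:]) * f (\<alpha> ! (j - Suc n))
      else 0)"

definition last_row_coeff ::
  "(nat \<Rightarrow> 'a::field poly) \<Rightarrow> (nat \<Rightarrow> 'a) \<Rightarrow> nat \<Rightarrow> nat list \<Rightarrow> nat \<Rightarrow> 'a" where
  "last_row_coeff f a n \<alpha> d = pf (Suc n + length \<alpha>)
     (set_row n (\<lambda>j. coeff (last_row f a n \<alpha> j) d)
        (bordered (Suc n) (schur_kernel a) (map (\<lambda>s i. poly (f s) (a i)) \<alpha>)))"

lemma prod_linear_degree:
  fixes a :: "nat \<Rightarrow> 'a::field"
  assumes "finite I"
  shows "degree (\<Prod>i\<in>I. [:a i, 1:]) = card I" "lead_coeff (\<Prod>i\<in>I. [:a i, 1:]) = 1"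
proof -
  show "degree (\<Prod>i\<in>I. [:a i, 1:]) = card I"
    using assms by (subst degree_prod_eq_sum_degree) auto
  show "lead_coeff (\<Prod>i\<in>I. [:a i, 1:]) = 1"
    by (simp add: lead_coeff_prod)
qed

lemma clear_denominators:
  fixes f :: "nat \<Rightarrow> 'a::field poly"
  assumes ev: "even (Suc n + length \<alpha>)" and nz: "\<And>i. i < n \<Longrightarrow> a i + t \<noteq> 0"
  shows "(\<Prod>i<n. a i + t) * nimmo f (a(n := t)) (Suc n) \<alpha> = pf (Suc n + length \<alpha>)
     (set_row n (\<lambda>j. poly (last_row f a n \<alpha> j) t)
        (bordered (Suc n) (schur_kernel a) (map (\<lambda>s i. poly (f s) (a i)) \<alpha>)))"
proof -
  let ?N = "Suc n + length \<alpha>"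
  let ?D = "\<Prod>i<n. a i + t"
  let ?cols = "\<lambda>a. map (\<lambda>s i. poly (f s) (a i :: 'a)) \<alpha>"
  let ?M = "bordered (Suc n) (schur_kernel (a(n := t))) (?cols (a(n := t)))"
  have alt: "alternating ?N ?M"
    using bordered_alternating[OF schur_kernel_alternating[of "Suc n" "a(n := t)"], of "?cols (a(n := t))"]
    by simp
  have "?D * pf ?N ?M = ?D * pf ?N (set_row n (?M n) ?M)"
    by (subst pf_set_row_self[OF alt]) simp_all
  also have "\<dots> = pf ?N (set_row n (\<lambda>j. ?D * ?M n j) ?M)"
    using pf_set_row_sum[of ?N n "\<lambda>_. ?D" "\<lambda>_. ?M n" "{()}" ?M] ev by simp
  also have "\<dots> = pf ?N (set_row n (\<lambda>j. poly (last_row f a n \<alpha> j) t)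
        (bordered (Suc n) (schur_kernel a) (?cols a)))"
  proof (rule pf_cong)
    have row: "?D * ?M n j = poly (last_row f a n \<alpha> j) t" if "j < ?N" "j \<noteq> n" for j
    proof (cases "j < n")
      case True
      have "?D = (a j + t) * (\<Prod>i\<in>{..<n} - {j}. a i + t)"
        using True by (subst prod.remove[of _ j]) auto
      then show ?thesis using True nz[OF True]
        by (simp add: last_row_def bordered_def schur_kernel_def poly_prod) (simp add: algebra_simps)
    next
      case False
      then have "n < j" using that by simp
      then show ?thesis using that
        by (simp add: last_row_def bordered_def poly_prod)
    qed
    fix i j assume ij: "i < j" "j < ?N"
    consider "i = n" | "j = n" | "i \<noteq> n" "j \<noteq> n" by blast
    then show "set_row n (\<lambda>j. ?D * ?M n j) ?M i j = set_row n (\<lambda>j. poly (last_row f a n \<alpha> j) t)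
        (bordered (Suc n) (schur_kernel a) (?cols a)) i j"
    proof cases
      case 1
      then show ?thesis using row[of j] ij by (simp add: set_row_def)
    next
      case 2
      then show ?thesis using row[of i] ij by (simp add: set_row_def)
    next
      case 3
      then show ?thesis using ij by (auto simp: set_row_def bordered_def schur_kernel_def)
    qed
  qed
  finally show ?thesis by (simp add: nimmo_def bordered_pf_def)
qed

text \<open>
  Positive integers are convenient points for specialization: in characteristic \<open>0\<close> the
  denominators \<open>a i + a j\<close> do not vanish there, and there are infinitely many choices for
  each coordinate.
\<close>

definition posints :: "(nat \<Rightarrow> nat) \<Rightarrow> nat \<Rightarrow> 'a::field_char_0" where
  "posints b i = of_nat (Suc (b i))"

lemma posints_add_nonzero: "posints b i + of_nat (Suc x) \<noteq> (0 :: 'a::field_char_0)"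
  unfolding posints_def of_nat_add[symmetric] of_nat_eq_0_iff by simp

text \<open>
  For fixed values of the first \<open>n\<close> coordinates, the relation times its common denominator is a
  polynomial in the last coordinate with all positive integers as roots.
\<close>

lemma last_row_coeffs_vanish:
  fixes f :: "nat \<Rightarrow> 'a::field_char_0 poly"
  assumes L: "finite L" and ev: "\<And>l. l \<in> L \<Longrightarrow> even (Suc n + length (\<alpha> l))"
    and van: "\<And>b. (\<Sum>l\<in>L. c l * nimmo f (posints b) (Suc n) (\<alpha> l)) = 0"
  shows "(\<Sum>l\<in>L. c l * last_row_coeff f (posints b) n (\<alpha> l) d) = 0"
proof -
  define a where "a = (posints b :: nat \<Rightarrow> 'a)"
  \<comment> \<open>A common degree bound; the summand \<open>d\<close> puts the coefficient in question among those compared.\<close>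
  define E where "E = d + (\<Sum>l\<in>L. \<Sum>j<Suc n + length (\<alpha> l). degree (last_row f a n (\<alpha> l) j))"
  let ?k = "\<lambda>e. \<Sum>l\<in>L. c l * last_row_coeff f a n (\<alpha> l) e"
  define p where "p = (\<Sum>e\<le>E. monom (?k e) e)"
  have deg: "degree (last_row f a n (\<alpha> l) j) \<le> E" if "l \<in> L" "j < Suc n + length (\<alpha> l)" for l j
  proof -
    have "degree (last_row f a n (\<alpha> l) j) \<le> (\<Sum>j<Suc n + length (\<alpha> l). degree (last_row f a n (\<alpha> l) j))"
      by (rule member_le_sum) (use that in auto)
    also have "\<dots> \<le> (\<Sum>l\<in>L. \<Sum>j<Suc n + length (\<alpha> l). degree (last_row f a n (\<alpha> l) j))"
      by (rule member_le_sum[where f = "\<lambda>l. \<Sum>j<Suc n + length (\<alpha> l). degree (last_row f a n (\<alpha> l) j)"])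
        (use that L in auto)
    finally show ?thesis by (simp add: E_def)
  qed
  have root: "poly p (of_nat (Suc x)) = 0" for x
  proof -
    let ?t = "of_nat (Suc x) :: 'a"
    let ?D = "\<Prod>i<n. a i + ?t"
    have nz: "a i + ?t \<noteq> 0" for i unfolding a_def by (rule posints_add_nonzero)
    have ab: "posints (b(n := x)) = a(n := ?t)" by (auto simp: a_def posints_def fun_eq_iff)
    have one: "(\<Sum>e\<le>E. last_row_coeff f a n (\<alpha> l) e * ?t ^ e) = ?D * nimmo f (a(n := ?t)) (Suc n) (\<alpha> l)"
      if l: "l \<in> L" for l
    proof -
      let ?N = "Suc n + length (\<alpha> l)"
      let ?M = "bordered (Suc n) (schur_kernel a) (map (\<lambda>s i. poly (f s) (a i)) (\<alpha> l))"
      have poly: "poly (last_row f a n (\<alpha> l) j) ?t = (\<Sum>e\<le>E. ?t ^ e * coeff (last_row f a n (\<alpha> l) j) e)"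
        if j: "j < ?N" for j
        unfolding poly_altdef
        by (rule sum.mono_neutral_cong_left)
          (use deg[OF l j] in \<open>auto simp: coeff_eq_0 mult.commute\<close>)
      have "?D * nimmo f (a(n := ?t)) (Suc n) (\<alpha> l) = pf ?N (set_row n (\<lambda>j. poly (last_row f a n (\<alpha> l) j) ?t) ?M)"
        by (rule clear_denominators[OF ev[OF l] nz])
      also have "\<dots> = pf ?N (set_row n (\<lambda>j. \<Sum>e\<le>E. ?t ^ e * coeff (last_row f a n (\<alpha> l) j) e) ?M)"
        by (rule pf_cong) (auto simp: set_row_def poly simp del: of_nat_Suc)
      also have "\<dots> = (\<Sum>e\<le>E. ?t ^ e * last_row_coeff f a n (\<alpha> l) e)"
        unfolding last_row_coeff_def by (rule pf_set_row_sum[OF ev[OF l]]) simp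
      finally show ?thesis by (simp add: mult.commute)
    qed
    have "poly p ?t = (\<Sum>e\<le>E. \<Sum>l\<in>L. c l * (last_row_coeff f a n (\<alpha> l) e * ?t ^ e))"
      by (simp add: p_def poly_sum poly_monom sum_distrib_right mult.assoc)
    also have "\<dots> = (\<Sum>l\<in>L. c l * (\<Sum>e\<le>E. last_row_coeff f a n (\<alpha> l) e * ?t ^ e))"
      by (simp add: sum_distrib_left sum.swap[of _ "{..E}"])
    also have "\<dots> = ?D * (\<Sum>l\<in>L. c l * nimmo f (a(n := ?t)) (Suc n) (\<alpha> l))"
      using one by (simp add: sum_distrib_left mult.left_commute)
    finally show ?thesis using van[of "b(n := x)"] ab by simp
  qed
  have "p = 0"
  proof (rule ccontr)
    assume "p \<noteq> 0"
    then have "finite {x. poly p x = 0}" by (rule poly_roots_finite)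
    moreover have "range (\<lambda>x. of_nat (Suc x)) \<subseteq> {x. poly p x = 0}" using root by auto
    moreover have "inj (\<lambda>x. of_nat (Suc x) :: 'a)" by (rule injI) (simp only: of_nat_eq_iff nat.inject)
    ultimately show False using finite_subset range_inj_infinite by metis
  qed
  then have "coeff p d = 0" by simp
  moreover have "coeff p d = ?k d"
    by (simp add: p_def coeff_sum E_def)
  ultimately show ?thesis by (simp add: a_def)
qed

text \<open>
  The kernel tends to \<open>-1\<close> at infinity, so after clearing denominators its entries have degree
  \<open>n\<close>; the bordering entry with polynomial \<open>f_s\<close> has degree \<open>n + s\<close>.
\<close>

lemma last_row_top_coeffs:
  fixes f :: "nat \<Rightarrow> 'a::field poly"
  assumes adm: "\<And>d. degree (f d) = d"
  shows "j < n \<Longrightarrow> coeff (last_row f a n \<alpha> j) (n + m) = (if m = 0 then -1 else 0)"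
    and "k < length \<alpha> \<Longrightarrow> \<alpha> ! k \<le> m \<Longrightarrow> coeff (last_row f a n \<alpha> (Suc n + k)) (n + m)
       = (if \<alpha> ! k = m then lead_coeff (f m) else 0)"
proof -
  assume j: "j < n"
  let ?Q = "\<Prod>i\<in>{..<n} - {j}. [:a i, 1:]"
  obtain n' where n': "n = Suc n'" using j by (cases n) auto
  have Q: "degree ?Q = n'" "coeff ?Q n' = 1"
    using prod_linear_degree[of "{..<n} - {j}" a] j n' by auto
  have "coeff ?Q n = 0" using Q n' by (intro coeff_eq_0) simp
  then have "coeff ([:a j, -1:] * ?Q) n = - 1" using Q by (simp add: n')
  moreover have "coeff ([:a j, -1:] * ?Q) (n + m) = 0" if "m > 0"
  proof (rule coeff_eq_0)
    have "degree ([:a j, -1:] * ?Q) \<le> degree [:a j, -1:] + degree ?Q" by (rule degree_mult_le)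
    then show "degree ([:a j, -1:] * ?Q) < n + m" using Q n' that by simp
  qed
  ultimately show "coeff (last_row f a n \<alpha> j) (n + m) = (if m = 0 then -1 else 0)"
    using j by (simp add: last_row_def)
next
  assume k: "k < length \<alpha>" "\<alpha> ! k \<le> m"
  let ?D = "\<Prod>i<n. [:a i, 1:]"
  have D: "degree ?D = n" "coeff ?D n = 1"
    using prod_linear_degree[of "{..<n}" a] by auto
  have eq: "last_row f a n \<alpha> (Suc n + k) = ?D * f (\<alpha> ! k)" using k by (simp add: last_row_def)
  show "coeff (last_row f a n \<alpha> (Suc n + k)) (n + m) = (if \<alpha> ! k = m then lead_coeff (f m) else 0)"
  proof (cases "\<alpha> ! k = m")
    case True
    then show ?thesis unfolding eq
      using coeff_mult_degree_sum[of ?D "f m"] D adm[of m] by simp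
  next
    case False
    have "degree (?D * f (\<alpha> ! k)) \<le> degree ?D + degree (f (\<alpha> ! k))" by (rule degree_mult_le)
    also have "\<dots> < n + m" using False k D adm by simp
    finally show ?thesis unfolding eq using False by (simp add: coeff_eq_0)
  qed
qed

lemma last_row_at_diagonal: "last_row f a n \<alpha> n = 0"
  by (simp add: last_row_def)

text \<open>
  In this degree all entries of the row vanish.
\<close>

lemma last_row_coeff_zero:
  fixes f :: "nat \<Rightarrow> 'a::field poly"
  assumes adm: "\<And>d. degree (f d) = d" and ev: "even (Suc n + length \<alpha>)"
    and small: "\<forall>s\<in>set \<alpha>. s < m" and m: "0 < m"
  shows "last_row_coeff f a n \<alpha> (n + m) = 0"
proof -
  let ?N = "Suc n + length \<alpha>"
  let ?M = "bordered (Suc n) (schur_kernel a) (map (\<lambda>s i. poly (f s) (a i)) \<alpha>)"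
  have z: "coeff (last_row f a n \<alpha> j) (n + m) = 0" if "j < ?N" for j
  proof -
    consider "j < n" | "j = n" | "n < j" by linarith
    then show ?thesis
    proof cases
      case 1
      then show ?thesis using last_row_top_coeffs(1)[OF adm 1] m by simp
    next
      case 2
      then show ?thesis by (simp add: last_row_at_diagonal)
    next
      case 3
      define k where "k = j - Suc n"
      have k: "j = Suc n + k" "k < length \<alpha>" using 3 that by (simp_all add: k_def)
      then have "\<alpha> ! k < m" using small by simp
      then show ?thesis using k last_row_top_coeffs(2)[OF adm, where k = k and \<alpha> = \<alpha> and m = m and a = a and n = n] by simp
    qed
  qed
  have "last_row_coeff f a n \<alpha> (n + m) = pf ?N (set_row n (\<lambda>_. 0) ?M)"
    unfolding last_row_coeff_def by (rule pf_cong) (auto simp: set_row_def z)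
  also have "\<dots> = 0"
    using pf_set_row_sum[OF ev, of n "\<lambda>_. 0" "\<lambda>_ _. 0" "{} :: nat set" ?M] by simp
  finally show ?thesis .
qed

text \<open>
  In degree \<open>n + m\<close> only the entry of the column \<open>m\<close> survives in row \<open>n\<close>, so that both indices
  \<open>n\<close> and \<open>n + 1\<close> can be deleted. The permutation \<open>\<pi>\<close> moves them to the end, where
  \<open>pf_last_column\<close> applies. The factor \<open>e\<close> is independent of the point \<open>a\<close>, as is needed in
  order to carry a linear relation to fewer variables.
\<close>

lemma last_row_coeff_head:
  fixes f :: "nat \<Rightarrow> 'a::field poly"
  assumes adm: "\<And>d. degree (f d) = d" and ev: "even (n + length \<beta>)"
    and small: "\<forall>s\<in>set \<beta>. s < m" and m: "0 < m"
  shows "\<exists>e. e \<noteq> 0 \<and> (\<forall>a. last_row_coeff f a n (m # \<beta>) (n + m) = e * nimmo f a n \<beta>)"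
proof -
  define K where "K = n + length \<beta>"
  have evK: "even K" using ev by (simp add: K_def)
  define \<pi> where "\<pi> i = (if i < n then i else if i < K then i + 2 else if i = K then n + 1
     else if i = K + 1 then n else i)" for i
  have nK: "n \<le> K" by (simp add: K_def)
  have \<pi>: "\<pi> permutes {0..<K + 2}"
  proof (rule bij_imp_permutes)
    have inj: "inj_on \<pi> {0..<K + 2}"
      using nK by (auto simp: inj_on_def \<pi>_def split: if_splits)
    have "\<pi> ` {0..<K + 2} \<subseteq> {0..<K + 2}" using nK by (auto simp: \<pi>_def)
    from endo_inj_surj[OF _ this inj] show "bij_betw \<pi> {0..<K + 2} {0..<K + 2}"
      using inj by (simp add: bij_betw_def)
  qed (use nK in \<open>auto simp: \<pi>_def\<close>)
  define e where "e = - (of_int (sign \<pi>) * lead_coeff (f m))"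
  have "f m \<noteq> 0" using adm[of m] m by auto
  moreover have "of_int (sign \<pi>) \<noteq> (0 :: 'a)" by (simp add: sign_def)
  ultimately have "e \<noteq> 0" by (simp add: e_def)
  moreover have "last_row_coeff f a n (m # \<beta>) (n + m) = e * nimmo f a n \<beta>" for a
  proof -
    let ?r = "\<lambda>j. coeff (last_row f a n (m # \<beta>) j) (n + m)"
    let ?B = "bordered (Suc n) (schur_kernel a) (map (\<lambda>s i. poly (f s) (a i)) (m # \<beta>))"
    let ?M = "set_row n ?r ?B"
    have N: "Suc n + length (m # \<beta>) = K + 2" by (simp add: K_def)
    have altB: "alternating (K + 2) ?B"
      using bordered_alternating[OF schur_kernel_alternating[of "Suc n" a],
        of "map (\<lambda>s i. poly (f s) (a i)) (m # \<beta>)"] by (simp add: K_def)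
    have alt: "?M y x = - ?M x y" if "x < K + 2" "y < K + 2" "x \<noteq> y" for x y
      using alternatingD(2)[OF altB that(1,2)] that(3) by (simp add: set_row_def)
    have r_lt: "?r j = 0" if "j < n" for j using last_row_top_coeffs(1)[OF adm that] m by simp
    have r1: "?r (n + 1) = lead_coeff (f m)"
      using last_row_top_coeffs(2)[OF adm, where k = 0 and \<alpha> = "m # \<beta>" and m = m and a = a and n = n] by simp
    have r_ge: "?r (i + 2) = 0" if "n \<le> i" "i < K" for i
    proof -
      define k where "k = i - n"
      have k: "i = n + k" using that(1) by (simp add: k_def)
      have "k < length \<beta>" using that k by (simp add: K_def)
      then have "\<beta> ! k < m" using small by simp
      then show ?thesis
        using last_row_top_coeffs(2)[OF adm, where k = "Suc k" and \<alpha> = "m # \<beta>" and m = m and a = a and n = n] k \<open>k < length \<beta>\<close> by simp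
    qed
    have "of_int (sign \<pi>) * pf (K + 2) ?M = pf (K + 2) (\<lambda>i j. ?M (\<pi> i) (\<pi> j))"
      by (rule pf_permute[symmetric, OF alt _ \<pi>]) (use evK in auto)
    also have "\<dots> = ?M (\<pi> K) (\<pi> (K + 1)) * pf K (\<lambda>i j. ?M (\<pi> i) (\<pi> j))"
    proof (rule pf_last_column[OF evK])
      fix i assume i: "i < K"
      show "?M (\<pi> i) (\<pi> (K + 1)) = 0"
        using i nK r_lt[of i] r_ge[of i] by (cases "i < n") (simp_all add: \<pi>_def set_row_def)
    qed
    also have "?M (\<pi> K) (\<pi> (K + 1)) = - lead_coeff (f m)"
      using nK r1 by (simp add: \<pi>_def set_row_def)
    also have "pf K (\<lambda>i j. ?M (\<pi> i) (\<pi> j)) = nimmo f a n \<beta>"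
      unfolding nimmo_def bordered_pf_def length_map K_def[symmetric]
    proof (rule pf_cong)
      fix i j assume ij: "i < j" "j < K"
      consider "j < n" | "i < n" "n \<le> j" | "n \<le> i" by linarith
      then show "?M (\<pi> i) (\<pi> j) = bordered n (schur_kernel a) (map (\<lambda>s i. poly (f s) (a i)) \<beta>) i j"
      proof cases
        case 1
        then show ?thesis using ij by (simp add: \<pi>_def set_row_def bordered_def)
      next
        case 2
        then have "j + 2 - Suc n = Suc (j - n)" by simp
        then show ?thesis using ij 2 by (simp add: \<pi>_def set_row_def bordered_def)
      next
        case 3
        then show ?thesis using ij by (simp add: \<pi>_def set_row_def bordered_def)
      qed
    qed
    finally have *: "of_int (sign \<pi>) * pf (K + 2) ?M = - lead_coeff (f m) * nimmo f a n \<beta>" .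
    have "of_int (sign \<pi>) * of_int (sign \<pi>) = (1 :: 'a)" by (simp add: sign_def)
    then have "pf (K + 2) ?M = of_int (sign \<pi>) * (of_int (sign \<pi>) * pf (K + 2) ?M)"
      by (simp only: mult.assoc[symmetric]) simp
    also have "\<dots> = e * nimmo f a n \<beta>" unfolding * by (simp add: e_def)
    finally show ?thesis unfolding last_row_coeff_def N .
  qed
  ultimately show ?thesis by blast
qed

text \<open>
  In the limit the row turns into a bordering column of ones, which is the column of
  \<open>f_0\<close>.
\<close>

lemma last_row_coeff_nil:
  fixes f :: "nat \<Rightarrow> 'a::field poly"
  assumes adm: "\<And>d. degree (f d) = d" and f0: "f 0 = 1"
  shows "last_row_coeff f a n [] n = nimmo f a n [0]"
proof -
  have "coeff (last_row f a n [] j) n = - 1" if "j < n" for j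
    using last_row_top_coeffs(1)[OF adm that, where m = 0] by simp
  then have "pf (Suc n) (set_row n (\<lambda>j. coeff (last_row f a n [] j) n)
        (bordered (Suc n) (schur_kernel a) []))
     = pf (Suc n) (bordered n (schur_kernel a) [\<lambda>_. 1])"
    by (intro pf_cong) (auto simp: set_row_def bordered_def)
  then show ?thesis by (simp add: last_row_coeff_def nimmo_def bordered_pf_def f0)
qed

text \<open>
  In the limit row \<open>n\<close> agrees with the row of \<open>f_0\<close> except at these two indices. Their
  difference has a single nonzero entry, so both can be deleted.
\<close>

lemma last_row_coeff_zero_part:
  fixes f :: "nat \<Rightarrow> 'a::field_char_0 poly"
  assumes adm: "\<And>d. degree (f d) = d" and f0: "f 0 = 1" and ev: "even n"
  shows "last_row_coeff f a n [0] n = nimmo f a n []"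
proof -
  let ?r = "\<lambda>j. coeff (last_row f a n [0] j) n"
  let ?B = "bordered (Suc n) (schur_kernel a) (map (\<lambda>s i. poly (f s) (a i)) [0])"
  define M where "M = set_row n ?r ?B"
  have r_lt: "?r j = - 1" if "j < n" for j
    using last_row_top_coeffs(1)[OF adm that, where m = 0] by simp
  have r_n: "?r n = 0" by (simp add: last_row_at_diagonal)
  have r_1: "?r (Suc n) = 1"
    using last_row_top_coeffs(2)[OF adm, where k = 0 and \<alpha> = "[0]" and m = 0 and a = a and n = n] f0 by simp
  have altB: "alternating (n + 2) ?B"
    using bordered_alternating[OF schur_kernel_alternating[of "Suc n" a],
      of "map (\<lambda>s i. poly (f s) (a i)) [0]"] by simp
  have alt: "alternating (n + 2) M"
  proof (rule alternatingI)
    fix i j assume ij: "i < n + 2" "j < n + 2"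
    show "M j i = - M i j" unfolding M_def
      using alternatingD(2)[OF altB ij] r_n by (simp add: set_row_def)
  next
    fix i assume i: "i < n + 2"
    show "M i i = 0" unfolding M_def
      using alternatingD(1)[OF altB i] r_n by (simp add: set_row_def)
  qed
  \<comment> \<open>Subtract row \<open>n\<close> from row \<open>n + 1\<close>.\<close>
  define v where "v i = (if i = Suc n then -1 else 0 :: 'a)" for i
  let ?M' = "\<lambda>i j. M i j + v i * M n j + v j * M i n"
  have ent: "M i (Suc n) = 1" "M i n = 1" if "i < n" for i
    using that r_lt f0 by (simp_all add: M_def set_row_def bordered_def)
  have ent2: "M n (Suc n) = 1" "M n n = 0" using r_1 r_n by (simp_all add: M_def set_row_def)
  have "last_row_coeff f a n [0] n = pf (n + 2) M"
    by (simp add: last_row_coeff_def M_def)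
  also have "\<dots> = pf (n + 2) ?M'"
    by (rule pf_add_multiples_of_row[symmetric, OF _ _ _ _ alt]) (use ev in \<open>auto simp: v_def\<close>)
  also have "\<dots> = ?M' n (n + 1) * pf n ?M'"
    by (rule pf_last_column[OF ev]) (simp add: ent v_def)
  also have "?M' n (n + 1) = 1" by (simp add: ent2 v_def)
  also have "pf n ?M' = nimmo f a n []"
    unfolding nimmo_def bordered_pf_def by (simp, rule pf_cong) (auto simp: v_def M_def set_row_def bordered_def)
  finally show ?thesis by simp
qed

lemma pf_0: "pf 0 M = 1"
proof -
  have "canon_perms 0 = {id}" by (auto simp: canon_perms_def)
  then show ?thesis by (simp add: pf_def pf_term_def)
qed

lemma nimmo_0: "nimmo f a 0 [] = 1"
  by (simp add: nimmo_def bordered_pf_def pf_0)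

text \<open>
  The leading coefficient in the last coordinate is the same expression with one variable less,
  whatever the parity of \<open>n\<close>.
\<close>

lemma nimmo_empty_nonzero:
  fixes f :: "nat \<Rightarrow> 'a::field_char_0 poly"
  assumes adm: "\<And>d. degree (f d) = d" and f0: "f 0 = 1"
  shows "\<exists>b. nimmo f (posints b) n (pad n []) \<noteq> 0"
proof (induction n)
  case 0
  then show ?case by (simp add: pad_def nimmo_0)
next
  case (Suc n)
  show ?case
  proof (rule ccontr)
    assume "\<not> ?case"
    then have "(\<Sum>l\<in>{()}. 1 * nimmo f (posints b) (Suc n) (pad (Suc n) [])) = 0" for b by simp
    from last_row_coeffs_vanish[of "{()}" n "\<lambda>_. pad (Suc n) []", OF _ pad_even this]
    have "last_row_coeff f (posints b) n (pad (Suc n) []) n = 0" for b by simp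
    moreover have "last_row_coeff f a n (pad (Suc n) []) n = nimmo f a n (pad n [])" for a
      using last_row_coeff_nil[OF adm f0] last_row_coeff_zero_part[OF adm f0]
      by (simp add: pad_def append_zero_def)
    ultimately show False using Suc.IH by simp
  qed
qed

lemma strict_partition_Cons:
  "strict_partition (m # \<beta>) \<longleftrightarrow> 0 < m \<and> (\<forall>s\<in>set \<beta>. s < m) \<and> strict_partition \<beta>"
  by (auto simp: strict_partition_def)

text \<open>
  Let \<open>m\<close> be the largest part that occurs with a nonzero coefficient. In degree \<open>n + m\<close> of the
  last coordinate exactly the partitions with first part \<open>m\<close> survive, each without that
  part; deleting it and one variable preserves the parity and thus the padding. If only the
  empty partition is left, \<open>nimmo_empty_nonzero\<close> applies.
\<close>

lemma nimmo_independent: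
  fixes f :: "nat \<Rightarrow> 'a::field_char_0 poly"
  assumes adm: "\<And>d. degree (f d) = d" and f0: "f 0 = 1"
    and "finite L" "\<And>l. l \<in> L \<Longrightarrow> strict_partition l \<and> length l \<le> n"
    and "\<And>b. (\<Sum>l\<in>L. c l * nimmo f (posints b) n (pad n l)) = 0"
    and "l \<in> L"
  shows "c l = 0"
  using assms(3-)
proof (induction n arbitrary: L c l)
  case 0
  then have "L = {[]}" by auto
  with 0(3) 0(4) show ?case by (simp add: pad_def nimmo_0)
next
  case (Suc n)
  define L' where "L' = {l \<in> L. c l \<noteq> 0}"
  have finL': "finite L'" using Suc.prems(1) by (simp add: L'_def)
  have L'L: "strict_partition l \<and> length l \<le> Suc n" if "l \<in> L'" for l
    using Suc.prems(2) that by (simp add: L'_def)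
  have van: "(\<Sum>l\<in>L'. c l * nimmo f (posints b) (Suc n) (pad (Suc n) l)) = 0" for b
  proof -
    have "(\<Sum>l\<in>L'. c l * nimmo f (posints b) (Suc n) (pad (Suc n) l))
      = (\<Sum>l\<in>L. c l * nimmo f (posints b) (Suc n) (pad (Suc n) l))"
      unfolding L'_def by (rule sum.mono_neutral_left) (use Suc.prems(1) in auto)
    then show ?thesis using Suc.prems(3)[of b] by simp
  qed
  have van_coeff: "(\<Sum>l\<in>L'. c l * last_row_coeff f (posints b) n (pad (Suc n) l) d) = 0" for b d
    by (rule last_row_coeffs_vanish[OF finL' pad_even van])
  have "L' \<subseteq> {[]}"
  proof (rule ccontr)
    assume "\<not> L' \<subseteq> {[]}"
    then have ne: "hd ` (L' - {[]}) \<noteq> {}" by auto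
    define m where "m = Max (hd ` (L' - {[]}))"
    define Lm where "Lm = {l \<in> L'. l \<noteq> [] \<and> hd l = m}"
    have "m \<in> hd ` (L' - {[]})" unfolding m_def by (rule Max_in) (use finL' ne in auto)
    then obtain l0 where l0: "l0 \<in> Lm" by (auto simp: Lm_def)
    have Lm: "l = m # tl l" "strict_partition (m # tl l)" "length (tl l) \<le> n" if "l \<in> Lm" for l
      using that L'L[of l] by (cases l; auto simp: Lm_def)+
    have m: "0 < m" using Lm(2)[OF l0] by (simp add: strict_partition_Cons)
    have hd_le: "hd l \<le> m" if "l \<in> L'" "l \<noteq> []" for l
      unfolding m_def by (rule Max_ge) (use finL' that in auto)
    have zero: "last_row_coeff f a n (pad (Suc n) l) (n + m) = 0" if l: "l \<in> L' - Lm" for l a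
    proof (rule last_row_coeff_zero[OF adm pad_even _ m])
      have "\<forall>s\<in>set l. s < m"
      proof (cases l)
        case (Cons x xs)
        then have "x < m" using l hd_le[of l] by (auto simp: Lm_def)
        then show ?thesis using L'L[of l] l Cons by (auto simp: strict_partition_Cons)
      qed simp
      then show "\<forall>s\<in>set (pad (Suc n) l). s < m" using m by (simp add: pad_def append_zero_def)
    qed
    have pad_tl: "pad (Suc n) (m # \<beta>) = m # pad n \<beta>" for \<beta>
      by (simp add: pad_def append_zero_def)
    have "\<exists>e. e \<noteq> 0 \<and> (\<forall>a. last_row_coeff f a n (pad (Suc n) (m # \<beta>)) (n + m) = e * nimmo f a n (pad n \<beta>))"
      if "strict_partition (m # \<beta>)" for \<beta>
      unfolding pad_tl
      by (rule last_row_coeff_head[OF adm pad_even _ m])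
        (use that m in \<open>auto simp: strict_partition_Cons pad_def append_zero_def\<close>)
    then obtain e where e: "\<And>\<beta>. strict_partition (m # \<beta>) \<Longrightarrow> e \<beta> \<noteq> 0"
      "\<And>\<beta> a. strict_partition (m # \<beta>) \<Longrightarrow>
        last_row_coeff f a n (pad (Suc n) (m # \<beta>)) (n + m) = e \<beta> * nimmo f a n (pad n \<beta>)"
      by metis
    have inj: "inj_on tl Lm" by (rule inj_onI) (metis Lm(1))
    have "c (m # tl l0) * e (tl l0) = 0"
    proof (rule Suc.IH[where L = "tl ` Lm" and l = "tl l0" and c = "\<lambda>\<beta>. c (m # \<beta>) * e \<beta>"])
      show "finite (tl ` Lm)" using finL' by (simp add: Lm_def)
      show "strict_partition \<beta> \<and> length \<beta> \<le> n" if "\<beta> \<in> tl ` Lm" for \<beta>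
        using that Lm(2,3) by (auto simp: strict_partition_Cons)
      show "tl l0 \<in> tl ` Lm" using l0 by blast
      show "(\<Sum>\<beta>\<in>tl ` Lm. c (m # \<beta>) * e \<beta> * nimmo f (posints b) n (pad n \<beta>)) = 0" for b
      proof -
        have "(\<Sum>\<beta>\<in>tl ` Lm. c (m # \<beta>) * e \<beta> * nimmo f (posints b) n (pad n \<beta>))
          = (\<Sum>l\<in>Lm. c (m # tl l) * e (tl l) * nimmo f (posints b) n (pad n (tl l)))"
          by (simp add: sum.reindex[OF inj])
        also have "\<dots> = (\<Sum>l\<in>Lm. c l * last_row_coeff f (posints b) n (pad (Suc n) l) (n + m))"
        proof (rule sum.cong[OF refl])
          fix l assume "l \<in> Lm"
          from e(2)[OF Lm(2)[OF this], of "posints b"] Lm(1)[OF this]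
          show "c (m # tl l) * e (tl l) * nimmo f (posints b) n (pad n (tl l))
            = c l * last_row_coeff f (posints b) n (pad (Suc n) l) (n + m)" by (simp add: mult.assoc)
        qed
        also have "\<dots> = (\<Sum>l\<in>L'. c l * last_row_coeff f (posints b) n (pad (Suc n) l) (n + m))"
          by (rule sum.mono_neutral_left[OF finL']) (auto simp: Lm_def zero[unfolded Lm_def])
        finally show ?thesis using van_coeff by simp
      qed
    qed
    then have "c l0 = 0" using e(1)[OF Lm(2)[OF l0]] Lm(1)[OF l0] by simp
    then show False using l0 by (simp add: Lm_def L'_def)
  qed
  moreover have "[] \<notin> L'"
  proof
    assume "[] \<in> L'"
    then have "L' = {[]}" "c [] \<noteq> 0" using \<open>L' \<subseteq> {[]}\<close> by (auto simp: L'_def)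
    then show False using van nimmo_empty_nonzero[OF adm f0, of "Suc n"] by auto
  qed
  ultimately show ?case using Suc.prems(4) by (auto simp: L'_def)
qed

section \<open>Specialization of rational functions and uniqueness of coefficients\<close>

type_synonym 'a mpoly = "(nat \<Rightarrow>\<^sub>0 nat) \<Rightarrow>\<^sub>0 'a"

definition eval_monom :: "(nat \<Rightarrow> 'a::comm_ring_1) \<Rightarrow> (nat \<Rightarrow>\<^sub>0 nat) \<Rightarrow> 'a" where
  "eval_monom a m = (\<Prod>i\<in>Poly_Mapping.keys m. a i ^ Poly_Mapping.lookup m i)"

definition eval_mpoly :: "(nat \<Rightarrow> 'a::comm_ring_1) \<Rightarrow> 'a mpoly \<Rightarrow> 'a" where
  "eval_mpoly a p = (\<Sum>m\<in>Poly_Mapping.keys p. Poly_Mapping.lookup p m * eval_monom a m)"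

lemma eval_monom_add: "eval_monom a (m + m') = eval_monom a m * eval_monom a m'"
proof -
  let ?X = "Poly_Mapping.keys m \<union> Poly_Mapping.keys m'"
  have sup: "eval_monom a k = (\<Prod>i\<in>?X. a i ^ Poly_Mapping.lookup k i)"
    if "Poly_Mapping.keys k \<subseteq> ?X" for k
    unfolding eval_monom_def
    by (rule prod.mono_neutral_left) (use that in \<open>auto simp: in_keys_iff\<close>)
  have "eval_monom a (m + m') = (\<Prod>i\<in>?X. a i ^ Poly_Mapping.lookup (m + m') i)"
    by (rule sup[OF keys_add])
  also have "\<dots> = (\<Prod>i\<in>?X. a i ^ Poly_Mapping.lookup m i) * (\<Prod>i\<in>?X. a i ^ Poly_Mapping.lookup m' i)"
    by (simp add: lookup_add power_add prod.distrib)
  finally show ?thesis using sup[of m] sup[of m'] by simp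
qed

lemma eval_mpoly_add: "eval_mpoly a (p + q) = eval_mpoly a p + eval_mpoly a q"
  unfolding eval_mpoly_def
  by (rule setsum_keys_plus_distrib) (simp_all add: distrib_right)

lemma eval_mpoly_0: "eval_mpoly a 0 = 0"
  by (simp add: eval_mpoly_def)

lemma eval_mpoly_sum: "eval_mpoly a (sum g I) = (\<Sum>i\<in>I. eval_mpoly a (g i))"
  by (induction I rule: infinite_finite_induct) (simp_all add: eval_mpoly_add eval_mpoly_0)

lemma eval_mpoly_single: "eval_mpoly a (Poly_Mapping.single m c) = c * eval_monom a m"
  by (simp add: eval_mpoly_def)

lemma mpoly_sum_monomials:
  "p = (\<Sum>m\<in>Poly_Mapping.keys p. Poly_Mapping.single m (Poly_Mapping.lookup p m))"
proof (rule poly_mapping_eqI)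
  fix k
  have "(\<Sum>m\<in>Poly_Mapping.keys p. Poly_Mapping.lookup (Poly_Mapping.single m (Poly_Mapping.lookup p m)) k)
     = (\<Sum>m\<in>Poly_Mapping.keys p. if m = k then Poly_Mapping.lookup p m else 0)"
    by (rule sum.cong) (auto simp: lookup_single when_def)
  also have "\<dots> = Poly_Mapping.lookup p k" by (simp add: in_keys_iff)
  finally show "Poly_Mapping.lookup p k
     = Poly_Mapping.lookup (\<Sum>m\<in>Poly_Mapping.keys p. Poly_Mapping.single m (Poly_Mapping.lookup p m)) k"
    by (simp add: lookup_sum)
qed

lemma eval_mpoly_mult: "eval_mpoly a (p * q) = eval_mpoly a p * eval_mpoly a q"
proof -
  let ?s = "\<lambda>p m. Poly_Mapping.single m (Poly_Mapping.lookup p m)"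
  have "p * q = (\<Sum>m\<in>Poly_Mapping.keys p. ?s p m) * (\<Sum>m\<in>Poly_Mapping.keys q. ?s q m)"
    using mpoly_sum_monomials[of p] mpoly_sum_monomials[of q] by simp
  then have "eval_mpoly a (p * q) = (\<Sum>m\<in>Poly_Mapping.keys p. \<Sum>m'\<in>Poly_Mapping.keys q.
      (Poly_Mapping.lookup p m * eval_monom a m) * (Poly_Mapping.lookup q m' * eval_monom a m'))"
    by (simp add: sum_product eval_mpoly_sum mult_single eval_mpoly_single eval_monom_add mult_ac)
  also have "\<dots> = eval_mpoly a p * eval_mpoly a q"
    by (simp only: eval_mpoly_def sum_product)
  finally show ?thesis .
qed

lemma eval_mpoly_1: "eval_mpoly a 1 = 1"
  using eval_mpoly_single[of a 0 1] by (simp add: eval_monom_def)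

lemma eval_mpoly_uminus: "eval_mpoly a (- p) = - eval_mpoly a p"
  using eval_mpoly_add[of a p "- p"] by (simp add: eval_mpoly_0 eq_neg_iff_add_eq_0 add.commute)

text \<open>
  Substituting \<open>a\<close> for the indeterminates is a partial map on rational functions, defined where
  some denominator does not vanish at \<open>a\<close>. As a relation it can be transported through sums,
  products and quotients without fixing representatives.
\<close>

definition specializes :: "(nat \<Rightarrow> 'a::field_char_0) \<Rightarrow> 'a ratfun \<Rightarrow> 'a \<Rightarrow> bool" where
  "specializes a x v \<longleftrightarrow> (\<exists>p d. eval_mpoly a d \<noteq> 0 \<and> x = to_fract p / to_fract d \<and>
     v = eval_mpoly a p / eval_mpoly a d)"

lemma specializes_to_fract: "specializes a (to_fract p) (eval_mpoly a p)"
  unfolding specializes_def by (rule exI[of _ p], rule exI[of _ 1]) (simp add: eval_mpoly_1)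

lemma eval_mpoly_nonzero: "eval_mpoly a d \<noteq> 0 \<Longrightarrow> d \<noteq> 0"
  by (auto simp: eval_mpoly_0)

text \<open>
  The only use of specialization is to turn identities in the function field into identities of
  values.
\<close>

lemma specializes_zero_imp:
  assumes "specializes a 0 v"
  shows "v = 0"
proof -
  obtain p d where pd: "eval_mpoly a d \<noteq> 0" "0 = to_fract p / to_fract d"
    "v = eval_mpoly a p / eval_mpoly a d" using assms by (auto simp: specializes_def)
  have "to_fract d \<noteq> 0" using eval_mpoly_nonzero[OF pd(1)] by simp
  then have "to_fract p = 0" using pd(2) by simp
  then have "p = 0" by simp
  then show ?thesis using pd(3) by (simp add: eval_mpoly_0)
qed

lemma specializes_add:
  assumes "specializes a x v" "specializes a y w"
  shows "specializes a (x + y) (v + w)"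
proof -
  obtain p d q e where *: "eval_mpoly a d \<noteq> 0" "x = to_fract p / to_fract d"
    "v = eval_mpoly a p / eval_mpoly a d" "eval_mpoly a e \<noteq> 0" "y = to_fract q / to_fract e"
    "w = eval_mpoly a q / eval_mpoly a e"
    using assms unfolding specializes_def by blast
  have nz: "to_fract d \<noteq> 0" "to_fract e \<noteq> 0"
    using eval_mpoly_nonzero[OF *(1)] eval_mpoly_nonzero[OF *(4)] by simp_all
  show ?thesis unfolding specializes_def
  proof (intro exI conjI)
    show "eval_mpoly a (d * e) \<noteq> 0" using * by (simp add: eval_mpoly_mult)
    show "x + y = to_fract (p * e + q * d) / to_fract (d * e)"
      using nz unfolding *(2,5) by (simp add: add_frac_eq)
    show "v + w = eval_mpoly a (p * e + q * d) / eval_mpoly a (d * e)"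
      using *(1,4) unfolding *(3,6) by (simp add: eval_mpoly_mult eval_mpoly_add add_frac_eq)
  qed
qed

lemma specializes_mult:
  assumes "specializes a x v" "specializes a y w"
  shows "specializes a (x * y) (v * w)"
proof -
  obtain p d q e where *: "eval_mpoly a d \<noteq> 0" "x = to_fract p / to_fract d"
    "v = eval_mpoly a p / eval_mpoly a d" "eval_mpoly a e \<noteq> 0" "y = to_fract q / to_fract e"
    "w = eval_mpoly a q / eval_mpoly a e"
    using assms unfolding specializes_def by blast
  show ?thesis unfolding specializes_def
  proof (intro exI conjI)
    show "eval_mpoly a (d * e) \<noteq> 0" using * by (simp add: eval_mpoly_mult)
    show "x * y = to_fract (p * q) / to_fract (d * e)" unfolding *(2,5) by simp
    show "v * w = eval_mpoly a (p * q) / eval_mpoly a (d * e)"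
      unfolding *(3,6) by (simp add: eval_mpoly_mult)
  qed
qed

lemma specializes_inverse:
  assumes "specializes a x v" "v \<noteq> 0"
  shows "specializes a (inverse x) (inverse v)"
proof -
  obtain p d where *: "eval_mpoly a d \<noteq> 0" "x = to_fract p / to_fract d"
    "v = eval_mpoly a p / eval_mpoly a d"
    using assms unfolding specializes_def by blast
  show ?thesis unfolding specializes_def
  proof (intro exI conjI)
    show "eval_mpoly a p \<noteq> 0" using * assms(2) by auto
    show "inverse x = to_fract d / to_fract p" unfolding *(2) by simp
    show "inverse v = eval_mpoly a d / eval_mpoly a p" unfolding *(3) by simp
  qed
qed

lemma specializes_divide:
  assumes "specializes a x v" "specializes a y w" "w \<noteq> 0"
  shows "specializes a (x / y) (v / w)"
  using specializes_mult[OF assms(1) specializes_inverse[OF assms(2,3)]]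
  by (simp add: divide_inverse)

lemma specializes_0: "specializes a 0 0"
  using specializes_to_fract[of a 0] by (simp add: eval_mpoly_0)

lemma specializes_1: "specializes a 1 1"
  using specializes_to_fract[of a 1] by (simp add: eval_mpoly_1)

lemma specializes_uminus: "specializes a x v \<Longrightarrow> specializes a (- x) (- v)"
  using specializes_mult[OF specializes_to_fract[of a "- 1"], of x v]
  by (simp add: eval_mpoly_uminus eval_mpoly_1)

lemma specializes_diff:
  "specializes a x v \<Longrightarrow> specializes a y w \<Longrightarrow> specializes a (x - y) (v - w)"
  using specializes_add[OF _ specializes_uminus, of a x v y w] by simp

lemma specializes_sum:
  "(\<And>i. i \<in> I \<Longrightarrow> specializes a (g i) (h i)) \<Longrightarrow> specializes a (sum g I) (sum h I)"
  by (induction I rule: infinite_finite_induct) (auto intro: specializes_add specializes_0)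

lemma specializes_prod:
  "(\<And>i. i \<in> I \<Longrightarrow> specializes a (g i) (h i)) \<Longrightarrow> specializes a (prod g I) (prod h I)"
  by (induction I rule: infinite_finite_induct) (auto intro: specializes_mult specializes_1)

lemma specializes_const: "specializes a (const c) c"
  using specializes_to_fract[of a "Poly_Mapping.single 0 c"]
  by (simp add: const_def eval_mpoly_single eval_monom_def)

lemma specializes_indet: "specializes a (indet i) (a i)"
  using specializes_to_fract[of a "Poly_Mapping.single (Poly_Mapping.single i 1) 1"]
  by (simp add: indet_def eval_mpoly_single eval_monom_def)

lemma const_0: "const 0 = 0"
  by (simp add: const_def)

lemma const_1: "const 1 = 1"
  by (simp add: const_def)

lemma const_add: "const (c + d) = const c + const d"
  by (simp add: const_def single_add)

lemma const_mult: "const (c * d) = const c * const d"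
proof -
  have "Poly_Mapping.single 0 (c * d) = Poly_Mapping.single 0 c * (Poly_Mapping.single (0 :: nat \<Rightarrow>\<^sub>0 nat) d)"
    by (simp add: mult_single)
  then show ?thesis by (simp only: const_def to_fract_mult)
qed

lemma const_diff: "const (c - d) = const c - const d"
  by (simp add: const_def single_diff)

lemma specializes_poly:
  assumes "specializes a x v"
  shows "specializes a (poly (map_poly const p) x) (poly p v)"
proof (induction p)
  case 0
  then show ?case by (simp add: specializes_0)
next
  case (pCons c p)
  have "map_poly const (pCons c p) = pCons (const c) (map_poly const p)"
    using pCons by (intro map_poly_pCons) (auto simp: const_0)
  then show ?case
    using specializes_add[OF specializes_const specializes_mult[OF assms pCons.IH], of c] by simp
qed

lemma specializes_pf:
  assumes "\<And>i j. i < j \<Longrightarrow> j < N \<Longrightarrow> specializes a (M i j) (M' i j)"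
  shows "specializes a (pf N M) (pf N M')"
  unfolding pf_def pf_term_def
proof (intro specializes_sum specializes_mult specializes_prod)
  fix p assume p: "p \<in> canon_perms N"
  show "specializes a (of_int (sign p)) (of_int (sign p))"
    using specializes_1[of a] specializes_uminus[OF specializes_1[of a]] by (simp add: sign_def)
  fix i assume i: "i \<in> {..<N div 2}"
  show "specializes a (M (p (2*i)) (p (2*i+1))) (M' (p (2*i)) (p (2*i+1)))"
  proof (rule assms)
    show "p (2*i) < p (2*i+1)" using canon_permsD(2)[OF p] i by simp
    show "p (2*i+1) < N"
      using permutes_in_image[OF canon_permsD(1)[OF p], of "2*i+1"] i by auto
  qed
qed

abbreviation lift_seq :: "(nat \<Rightarrow> 'a::field_char_0 poly) \<Rightarrow> nat \<Rightarrow> 'a ratfun poly" where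
  "lift_seq f s \<equiv> map_poly const (f s)"

lemma specializes_nimmo:
  fixes f :: "nat \<Rightarrow> 'a::field_char_0 poly"
  assumes nz: "\<And>i j. i < j \<Longrightarrow> j < n \<Longrightarrow> a j + a i \<noteq> 0"
  shows "specializes a (nimmo (lift_seq f) indet n \<alpha>) (nimmo f a n \<alpha>)"
  unfolding nimmo_def bordered_pf_def length_map
proof (rule specializes_pf)
  fix i j assume ij: "i < j" "j < n + length \<alpha>"
  consider "j < n" | "i < n" "n \<le> j" | "n \<le> i" by linarith
  then show "specializes a
      (bordered n (schur_kernel indet) (map (\<lambda>s i. poly (lift_seq f s) (indet i)) \<alpha>) i j)
      (bordered n (schur_kernel a) (map (\<lambda>s i. poly (f s) (a i)) \<alpha>) i j)"
  proof cases
    case 1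
    then show ?thesis using ij nz[OF ij(1) 1]
      by (auto simp: bordered_def schur_kernel_def intro!: specializes_divide specializes_diff
          specializes_add specializes_indet)
  next
    case 2
    then show ?thesis using ij
      by (auto simp: bordered_def intro!: specializes_poly specializes_indet)
  next
    case 3
    then show ?thesis using ij by (simp add: bordered_def specializes_0)
  qed
qed

text \<open>
  It does not vanish at the point \<open>(1, 2, 3, \<dots>)\<close>.
\<close>

lemma Delta_nonzero: "Delta n \<noteq> (0 :: 'a::field_char_0 ratfun)"
proof
  assume 0: "Delta n = (0 :: 'a ratfun)"
  define a where "a i = (of_nat (Suc i) :: 'a)" for i
  define q where "q i j = (a j - a i) / (a j + a i)" for i j
  have nz: "a j + a i \<noteq> 0" for i j
    unfolding a_def of_nat_add[symmetric] of_nat_eq_0_iff by simp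
  have q: "q i j \<noteq> 0" if "i < j" for i j
    using nz[of j i] that by (simp add: q_def) (simp add: a_def)
  have "specializes a (Delta n) (\<Prod>(i,j)\<in>{(i,j). i < j \<and> j < n}. q i j)"
    unfolding Delta_def
    by (rule specializes_prod)
      (auto simp: q_def nz intro!: specializes_divide specializes_diff specializes_add specializes_indet)
  then have "(\<Prod>(i,j)\<in>{(i,j). i < j \<and> j < n}. q i j) = 0"
    unfolding 0 by (rule specializes_zero_imp)
  moreover have "finite {(i,j). i < j \<and> j < n}"
    by (rule finite_subset[of _ "{..<n} \<times> {..<n}"]) auto
  ultimately show False using q by (auto simp: prod_zero_iff)
qed

lemma gen_P_eq_nimmo: "gen_P f n lam = nimmo (lift_seq f) indet n (pad n lam) / Delta n"
proof -
  let ?l = "pad n lam"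
  let ?V = "V_mat f n ?l"
  let ?M = "four_block_mat (A_mat n) ?V (- transpose_mat ?V) (0\<^sub>m (length ?l) (length ?l))"
  have dims: "dim_row (A_mat n) = n" "dim_col (A_mat n) = n" "dim_row ?V = n" "dim_col ?V = length ?l"
    by (simp_all add: A_mat_def V_mat_def)
  have "pfaffian ?M = pf (n + length ?l) (\<lambda>i j. ?M $$ (i, j))"
    using pad_even[of n lam] by (subst pfaffian_eq_pf) (simp_all add: dims)
  also have "\<dots> = nimmo (lift_seq f) indet n ?l"
    unfolding nimmo_def bordered_pf_def length_map
  proof (rule pf_cong)
    fix i j assume "i < j" "j < n + length ?l"
    then show "?M $$ (i, j) = bordered n (schur_kernel indet)
        (map (\<lambda>s i. poly (lift_seq f s) (indet i)) ?l) i j"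
      by (auto simp: dims bordered_def schur_kernel_def A_mat_def V_mat_def eval_at_def)
  qed
  finally show ?thesis by (simp add: gen_P_def pad_def Let_def)
qed

lemma admissible_degree: "admissible f \<Longrightarrow> degree (f d) = d"
  by (cases "d = 0") (auto simp: admissible_def)

text \<open>
  The difference of two families of coefficients is a linear relation between the numerators;
  it specializes to all points with positive integer coordinates.
\<close>

lemma P_coeff_unique:
  fixes f :: "nat \<Rightarrow> 'a::field_char_0 poly"
  assumes adm: "admissible f"
    and c: "finite {l. c l \<noteq> 0}" "\<And>l. c l \<noteq> 0 \<Longrightarrow> strict_partition l \<and> length l \<le> n"
      "g = (\<Sum>l | c l \<noteq> 0. const (c l) * gen_P f n l)"
  shows "P_coeff f n g = c"
  unfolding P_coeff_def
proof (rule the_equality)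
  show "finite {l. c l \<noteq> 0} \<and> (\<forall>l. c l \<noteq> 0 \<longrightarrow> strict_partition l \<and> length l \<le> n) \<and>
      g = (\<Sum>l | c l \<noteq> 0. const (c l) * gen_P f n l)"
    using c by blast
next
  fix c' assume c': "finite {l. c' l \<noteq> 0} \<and> (\<forall>l. c' l \<noteq> 0 \<longrightarrow> strict_partition l \<and> length l \<le> n) \<and>
      g = (\<Sum>l | c' l \<noteq> 0. const (c' l) * gen_P f n l)"
  define L where "L = {l. c l \<noteq> 0} \<union> {l. c' l \<noteq> 0}"
  have fin: "finite L" using c(1) c' by (simp add: L_def)
  have ext: "(\<Sum>l | k l \<noteq> 0. const (k l) * gen_P f n l) = (\<Sum>l\<in>L. const (k l) * gen_P f n l)"
    if "{l. k l \<noteq> 0} \<subseteq> L" for k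
    by (rule sum.mono_neutral_left[OF fin that]) (auto simp: const_0)
  have "(\<Sum>l\<in>L. const (c l) * gen_P f n l) = (\<Sum>l\<in>L. const (c' l) * gen_P f n l)"
    using ext[of c] ext[of c'] c(3) c' by (auto simp: L_def)
  then have "(\<Sum>l\<in>L. const (c l - c' l) * gen_P f n l) = 0"
    by (simp add: const_diff left_diff_distrib sum_subtractf)
  then have "(\<Sum>l\<in>L. const (c l - c' l) * nimmo (lift_seq f) indet n (pad n l)) / Delta n = 0"
    by (simp add: gen_P_eq_nimmo sum_divide_distrib)
  then have zero: "(\<Sum>l\<in>L. const (c l - c' l) * nimmo (lift_seq f) indet n (pad n l)) = 0"
    using Delta_nonzero[where 'a = 'a, of n] by simp
  have van: "(\<Sum>l\<in>L. (c l - c' l) * nimmo f (posints b) n (pad n l)) = 0" for b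
  proof (rule specializes_zero_imp)
    have "posints b j + posints b i \<noteq> (0 :: 'a)" for i j
      using posints_add_nonzero[of b j "b i"] by (simp add: posints_def)
    then show "specializes (posints b) 0 (\<Sum>l\<in>L. (c l - c' l) * nimmo f (posints b) n (pad n l))"
      unfolding zero[symmetric]
      by (intro specializes_sum specializes_mult specializes_const specializes_nimmo)
  qed
  have eq: "c l - c' l = 0" if "l \<in> L" for l
    by (rule nimmo_independent[OF admissible_degree[OF adm] _ fin _ van that])
      (use adm c(2) c' in \<open>auto simp: admissible_def L_def\<close>)
  show "c' = c"
  proof
    show "c' l = c l" for l using eq[of l] by (cases "l \<in> L") (auto simp: L_def)
  qed
qed

section \<open>The coefficients in the defining relation of b\<close>

lemma geometric_quotient_nth:
  fixes c :: "'b::field"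
  shows "fps_nth ((1 + fps_const c * fps_X) / (1 - fps_const c * fps_X)) k
     = (if k = 0 then 1 else 2 * c ^ k)"
proof -
  define g where "g = Abs_fps (\<lambda>k. if k = 0 then 1 else 2 * c ^ k)"
  have "g * (1 - fps_const c * fps_X) = 1 + fps_const c * fps_X"
  proof (rule fps_ext)
    fix n
    have "g * (1 - fps_const c * fps_X) = g - fps_const c * (fps_X * g)"
      by (simp only: right_diff_distrib mult_1_right mult.commute[of g] mult.assoc)
    then show "fps_nth (g * (1 - fps_const c * fps_X)) n = fps_nth (1 + fps_const c * fps_X) n"
      by (cases n; cases "n - 1") (simp_all add: g_def)
  qed
  moreover have "1 - fps_const c * fps_X \<noteq> 0"
  proof
    assume "1 - fps_const c * fps_X = 0"
    then have "fps_nth (1 - fps_const c * fps_X) 0 = 0" by simp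
    then show False by simp
  qed
  ultimately have "(1 + fps_const c * fps_X) / (1 - fps_const c * fps_X) = g"
    by (metis nonzero_mult_div_cancel_right)
  then show ?thesis by (simp add: g_def)
qed

text \<open>
  The coefficient of \<open>z^k\<close> in \<open>p(u) (1 + u z) / (1 - u z)\<close>.
\<close>

definition times_q :: "'a::field_char_0 poly \<Rightarrow> nat \<Rightarrow> 'a poly" where
  "times_q p k = (if k = 0 then p else monom 2 k * p)"

lemma times_q_degree: "degree (times_q p k) \<le> degree p + k"
  unfolding times_q_def using degree_mult_le[of "monom 2 k" p]
  by (auto simp: degree_monom_eq add.commute)

text \<open>
  The degrees of an admissible sequence are \<open>0, 1, 2, \<dots>\<close>, so a polynomial is expanded by removing
  leading terms.
\<close>

lemma admissible_expand_exists:
  fixes f :: "nat \<Rightarrow> 'a::field poly"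
  assumes adm: "\<And>d. degree (f d) = d" and f0: "f 0 = 1" and "degree p \<le> d"
  shows "\<exists>c. (\<forall>s>d. c s = 0) \<and> p = (\<Sum>s\<le>d. smult (c s) (f s))"
  using assms(3)
proof (induction d arbitrary: p)
  case 0
  then obtain x where "p = [:x:]" by (auto elim: degree_eq_zeroE)
  then show ?case using f0 by (intro exI[of _ "\<lambda>s. if s = 0 then x else 0"]) simp
next
  case (Suc d)
  define x where "x = coeff p (Suc d) / lead_coeff (f (Suc d))"
  have "f (Suc d) \<noteq> 0" using adm[of "Suc d"] by auto
  then have lc: "coeff (f (Suc d)) (Suc d) \<noteq> 0" using adm[of "Suc d"] by (metis leading_coeff_neq_0)
  have "degree (p - smult x (f (Suc d))) \<le> d"
  proof (rule degree_le, intro allI impI)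
    fix i assume i: "d < i"
    show "coeff (p - smult x (f (Suc d))) i = 0"
    proof (cases "i = Suc d")
      case True
      then show ?thesis using lc adm[of "Suc d"] by (simp add: x_def)
    next
      case False
      then have "degree p < i" "degree (f (Suc d)) < i" using i Suc.prems adm[of "Suc d"] by auto
      then show ?thesis by (simp add: coeff_eq_0)
    qed
  qed
  from Suc.IH[OF this] obtain c where c: "\<forall>s>d. c s = 0"
    "p - smult x (f (Suc d)) = (\<Sum>s\<le>d. smult (c s) (f s))" by blast
  have "p = (\<Sum>s\<le>d. smult (c s) (f s)) + smult x (f (Suc d))" using c(2) by (simp add: algebra_simps)
  then show ?case using c(1)
    by (intro exI[of _ "c(Suc d := x)"]) auto
qed

lemma admissible_expand_unique:
  fixes f :: "nat \<Rightarrow> 'a::field poly"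
  assumes adm: "\<And>d. degree (f d) = d" and f0: "f 0 = 1"
    and "(\<Sum>s<d. smult (c s) (f s)) = 0" and "s < d"
  shows "c s = 0"
  using assms(3,4)
proof (induction d arbitrary: s)
  case (Suc d)
  have "f d \<noteq> 0" using adm[of d] f0 by (cases d) auto
  then have lc: "coeff (f d) d \<noteq> 0" using adm[of d] by (metis leading_coeff_neq_0)
  have "coeff (\<Sum>s<d. smult (c s) (f s)) d = 0"
    by (simp add: coeff_sum coeff_eq_0 adm)
  moreover have "coeff (\<Sum>s<Suc d. smult (c s) (f s)) d = 0" unfolding Suc.prems(1) by simp
  ultimately have "c d = 0" using lc by simp
  moreover from this have "(\<Sum>s<d. smult (c s) (f s)) = 0" using Suc.prems(1) by simp
  ultimately show ?case using Suc.IH[of s] Suc.prems(2) by (cases "s = d") auto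
qed simp

lemma to_fract_power: "to_fract (x ^ k) = to_fract x ^ k"
  by (induction k) simp_all

lemma pieri_b_sums_iff:
  fixes f :: "nat \<Rightarrow> 'a::field_char_0 poly"
  shows "(\<lambda>s. fps_embed (b s) * fps_const (to_fract (f s))) sums
             (fps_const (to_fract (f r)) *
              ((1 + fps_const (to_fract [:0, 1:]) * fps_X) /
               (1 - fps_const (to_fract [:0, 1:]) * fps_X)))
     \<longleftrightarrow> (\<forall>k. \<forall>\<^sub>F n in sequentially. (\<Sum>s<n. smult (fps_nth (b s) k) (f s)) = times_q (f r) k)"
proof -
  have "to_fract (times_q (f r) k) = to_fract (f r) * (if k = 0 then 1 else 2 * to_fract [:0, 1:] ^ k)" for k
  proof -
    have "to_fract ((1 :: 'a poly) + 1) = 1 + 1" by (simp only: to_fract_add to_fract_1)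
    then have two: "to_fract (2 :: 'a poly) = 2" by (simp only: one_add_one)
    have "smult 2 p = 2 * p" for p :: "'a poly"
      unfolding mult_2 by (rule poly_eqI) (simp only: coeff_smult coeff_add mult_2)
    then have "monom (2 :: 'a) k = 2 * [:0, 1:] ^ k" by (simp only: monom_altdef)
    then show ?thesis by (simp add: times_q_def to_fract_power two mult.commute)
  qed
  then have rhs: "fps_nth (fps_const (to_fract (f r)) *
              ((1 + fps_const (to_fract [:0, 1:]) * fps_X) /
               (1 - fps_const (to_fract [:0, 1:]) * fps_X))) k = to_fract (times_q (f r) k)" for k
    unfolding fps_mult_left_const_nth geometric_quotient_nth by simp
  have "to_fract [:c:] * to_fract p = to_fract (smult c p)" for c and p :: "'a poly"
    by (simp add: to_fract_mult[symmetric] del: to_fract_mult)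
  then have lhs: "fps_nth (\<Sum>s<n. fps_embed (b s) * fps_const (to_fract (f s))) k
     = to_fract (\<Sum>s<n. smult (fps_nth (b s) k) (f s))" for n k
    by (simp add: fps_sum_nth fps_embed_def)
  show ?thesis
    unfolding sums_def tendsto_fps_iff rhs lhs to_fract_eq_iff ..
qed

text \<open>
  The coefficient of \<open>z^k\<close> has degree at most \<open>r + k\<close>, so its expansion involves only \<open>f_s\<close> with
  \<open>s \<le> r + k\<close>. Such expansions define a family of series that converges to the required product, and the
  linear independence of the \<open>f_s\<close> shows that there is no other one.
\<close>

lemma pieri_b_expansion:
  fixes f :: "nat \<Rightarrow> 'a::field_char_0 poly"
  assumes "admissible f" and S: "r + k \<le> S"
  shows "(\<Sum>s\<le>S. smult (fps_nth (pieri_b f r s) k) (f s)) = times_q (f r) k"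
proof -
  note adm = admissible_degree[OF assms(1)]
  have f0: "f 0 = 1" using assms(1) by (simp add: admissible_def)
  have "\<exists>c. (\<forall>s>r+k. c s = 0) \<and> times_q (f r) k = (\<Sum>s\<le>r+k. smult (c s) (f s))" for k
    by (rule admissible_expand_exists[OF adm f0]) (use times_q_degree[of "f r" k] adm in simp)
  then obtain c where c: "\<And>k s. s > r + k \<Longrightarrow> c k s = 0"
    "\<And>k. times_q (f r) k = (\<Sum>s\<le>r+k. smult (c k s) (f s))" by metis
  define b where "b s = Abs_fps (\<lambda>k. c k s)" for s
  have long: "(\<Sum>s\<in>T. smult (fps_nth (b s) k) (f s)) = times_q (f r) k" if "{..r+k} \<subseteq> T" "finite T" for k T
    unfolding c(2) b_def fps_nth_Abs_fps
    by (rule sum.mono_neutral_right) (use that c(1) in \<open>auto simp: not_le\<close>)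
  have "pieri_b f r = b"
    unfolding pieri_b_def pieri_b_sums_iff
  proof (rule the_equality, intro allI)
    fix k
    show "\<forall>\<^sub>F n in sequentially. (\<Sum>s<n. smult (fps_nth (b s) k) (f s)) = times_q (f r) k"
      unfolding eventually_sequentially
      by (rule exI[of _ "Suc (r+k)"], intro allI impI long) auto
  next
    fix b' assume b': "\<forall>k. \<forall>\<^sub>F n in sequentially. (\<Sum>s<n. smult (fps_nth (b' s) k) (f s)) = times_q (f r) k"
    show "b' = b"
    proof (rule ext, rule fps_ext)
      fix s k
      obtain N where N: "\<And>n. n \<ge> N \<Longrightarrow> (\<Sum>s<n. smult (fps_nth (b' s) k) (f s)) = times_q (f r) k"
        using b' unfolding eventually_sequentially by metis
      define n where "n = N + s + Suc (r + k)"
      have n: "N \<le> n" "{..r+k} \<subseteq> {..<n}" "s < n" by (auto simp: n_def)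
      have "(\<Sum>s<n. smult (fps_nth (b' s) k) (f s)) = (\<Sum>s<n. smult (fps_nth (b s) k) (f s))"
        by (simp only: N[OF n(1)] long[OF n(2) finite_lessThan])
      then have "(\<Sum>s<n. smult (fps_nth (b' s) k - fps_nth (b s) k) (f s)) = 0"
        by (simp add: smult_diff_left sum_subtractf)
      from admissible_expand_unique[OF adm f0 this n(3)]
      show "fps_nth (b' s) k = fps_nth (b s) k" by simp
    qed
  qed
  then show ?thesis using long[of k "{..S}"] S by auto
qed

section \<open>The Pieri rule\<close>

lemma fps_const_hom: "comm_ring_hom (fps_const :: 'a::comm_ring_1 \<Rightarrow> 'a fps)"
  by unfold_locales simp_all

lemma const_sum: "const (sum g I) = (\<Sum>i\<in>I. const (g i))"
  by (induction I rule: infinite_finite_induct) (simp_all add: const_0 const_add)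

definition lift_fps :: "'a::field_char_0 fps \<Rightarrow> 'a ratfun fps" where
  "lift_fps b = Abs_fps (\<lambda>k. const (fps_nth b k))"

lemma lift_fps_nth: "fps_nth (lift_fps b) k = const (fps_nth b k)"
  by (simp add: lift_fps_def)

lemma lift_fps_hom: "comm_ring_hom (lift_fps :: 'a::field_char_0 fps \<Rightarrow> _)"
  by unfold_locales
    (rule fps_ext; simp add: lift_fps_nth fps_mult_nth fps_one_nth const_0 const_1 const_add const_mult const_sum)+

lemma pf_hom:
  assumes "comm_ring_hom h"
  shows "h (pf N M) = pf N (\<lambda>i j. h (M i j))"
proof -
  interpret comm_ring_hom h by fact
  show ?thesis by (simp add: pf_def pf_term_def hom_sum hom_mult hom_prod hom_of_int)
qed

lemma poly_lift_sum:
  "poly (map_poly const (\<Sum>t\<in>T. smult (c t) (p t))) x = (\<Sum>t\<in>T. const (c t) * poly (map_poly const (p t)) x)"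
proof -
  have "map_poly const (\<Sum>t\<in>T. smult (c t) (p t)) = (\<Sum>t\<in>T. smult (const (c t)) (map_poly const (p t)))"
    by (rule poly_eqI) (simp add: coeff_map_poly const_0 coeff_sum const_sum const_mult)
  then show ?thesis by (simp add: poly_sum)
qed

lemma const_2: "const 2 = 2"
  using const_add[of 1 1] by (simp only: const_1 one_add_one)

lemma poly_lift_times_q:
  "poly (map_poly const (times_q p k)) x = (if k = 0 then 1 else 2 * x ^ k) * poly (map_poly const p) x"
proof -
  have "map_poly const (monom 2 k * p) = monom 2 k * map_poly const p"
    by (rule poly_eqI) (simp add: coeff_map_poly const_0 coeff_monom_mult const_mult const_2)
  then show ?thesis by (simp add: times_q_def poly_monom)
qed

text \<open>
  Congruence modulo \<open>z^(r+1)\<close>. It serves to replace the infinite expansion of a column by a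
  finite one.
\<close>

definition agree :: "nat \<Rightarrow> 'b::comm_ring_1 fps \<Rightarrow> 'b fps \<Rightarrow> bool" where
  "agree r x y \<longleftrightarrow> (\<forall>k\<le>r. fps_nth x k = fps_nth y k)"

lemma agree_refl: "agree r x x"
  by (simp add: agree_def)

lemma agree_mult: "agree r x y \<Longrightarrow> agree r x' y' \<Longrightarrow> agree r (x * x') (y * y')"
  unfolding agree_def fps_mult_nth by (intro allI impI sum.cong) auto

lemma agree_sum: "(\<And>i. i \<in> I \<Longrightarrow> agree r (g i) (h i)) \<Longrightarrow> agree r (sum g I) (sum h I)"
  unfolding agree_def fps_sum_nth by (intro allI impI sum.cong) auto

lemma agree_prod: "(\<And>i. i \<in> I \<Longrightarrow> agree r (g i) (h i)) \<Longrightarrow> agree r (prod g I) (prod h I)"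
  by (induction I rule: infinite_finite_induct) (auto intro: agree_mult agree_refl)

lemma agree_pf:
  assumes "\<And>i j. i < j \<Longrightarrow> j < N \<Longrightarrow> agree r (M i j) (M' i j)"
  shows "agree r (pf N M) (pf N M')"
  unfolding pf_def pf_term_def
proof (intro agree_sum agree_mult agree_prod)
  fix p assume p: "p \<in> canon_perms N"
  fix i assume i: "i \<in> {..<N div 2}"
  show "agree r (M (p (2*i)) (p (2*i+1))) (M' (p (2*i)) (p (2*i+1)))"
  proof (rule assms)
    show "p (2*i) < p (2*i+1)" using canon_permsD(2)[OF p] i by simp
    show "p (2*i+1) < N"
      using permutes_in_image[OF canon_permsD(1)[OF p], of "2*i+1"] i by auto
  qed
qed (rule agree_refl)

definition q_factor :: "nat \<Rightarrow> 'a::field_char_0 ratfun fps" where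
  "q_factor i = (1 + fps_const (indet i) * fps_X) / (1 - fps_const (indet i) * fps_X)"

definition kernel_fps :: "nat \<Rightarrow> nat \<Rightarrow> 'a::field_char_0 ratfun fps" where
  "kernel_fps i j = fps_const (schur_kernel indet i j)"

definition column :: "(nat \<Rightarrow> 'a::field_char_0 poly) \<Rightarrow> nat \<Rightarrow> nat \<Rightarrow> 'a ratfun fps" where
  "column f s i = fps_const (poly (lift_seq f s) (indet i))"

lemma kernel_fps_alternating: "alternating n kernel_fps"
proof (rule alternatingI)
  show "kernel_fps i i = 0" if "i < n" for i
    using alternatingD(1)[OF schur_kernel_alternating that] by (simp add: kernel_fps_def)
  show "kernel_fps j i = - kernel_fps i j" if "i < n" "j < n" for i j
    unfolding kernel_fps_def alternatingD(2)[OF schur_kernel_alternating that] by simp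
qed

lemma bordered_pf_columns: "bordered_pf n kernel_fps (map (column f) \<alpha>) = fps_const (nimmo (lift_seq f) indet n \<alpha>)"
  unfolding nimmo_def bordered_pf_def pf_hom[OF fps_const_hom] length_map
  by (rule pf_cong) (auto simp: bordered_def kernel_fps_def column_def)

lemma indet_add_nonzero: "indet i + indet j \<noteq> (0 :: 'a::field_char_0 ratfun)"
proof
  assume 0: "indet i + indet j = (0 :: 'a ratfun)"
  have "specializes (\<lambda>_. 1) (indet i + indet j) (1 + 1 :: 'a)"
    by (rule specializes_add[OF specializes_indet specializes_indet])
  then have "(1 + 1 :: 'a) = 0" unfolding 0 by (rule specializes_zero_imp)
  then show False by simp
qed

lemma two_nonzero: "(2 :: 'a::field_char_0 ratfun fps) \<noteq> 0"
proof
  assume "(2 :: 'a ratfun fps) = 0"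
  then have "fps_nth (1 + 1 :: 'a ratfun fps) 0 = 0" by simp
  then have 0: "1 + 1 = (0 :: 'a ratfun)" by (simp only: fps_add_nth fps_one_nth refl if_True)
  have "specializes (\<lambda>_. 1) (1 + 1) (1 + 1 :: 'a)"
    by (rule specializes_add[OF specializes_1 specializes_1])
  then have "(1 + 1 :: 'a) = 0" unfolding 0 by (rule specializes_zero_imp)
  then show False by simp
qed

text \<open>
  With \<open>g(u) = (1 + u z) / (1 - u z)\<close>, both \<open>(y + x) (g(y) - g(x))\<close> and
  \<open>(y - x) (g(x) g(y) - 1)\<close> equal \<open>2 z (y - x) (y + x) / ((1 - x z) (1 - y z))\<close>.
\<close>

lemma q_factor_kernel:
  "q_factor i * q_factor j * kernel_fps i j
    = (kernel_fps i j + q_factor j - q_factor i :: 'a::field_char_0 ratfun fps)"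
proof -
  let ?a = "fps_const (indet i) :: 'a ratfun fps" and ?b = "fps_const (indet j) :: 'a ratfun fps"
  let ?Di = "1 - ?a * fps_X" and ?Dj = "1 - ?b * fps_X"
  let ?Ni = "1 + ?a * fps_X" and ?Nj = "1 + ?b * fps_X"
  have unit: "fps_nth (1 - fps_const c * fps_X) 0 \<noteq> 0" for c :: "'a ratfun" by simp
  have gD: "q_factor k * (1 - fps_const (indet k) * fps_X) = (1 + fps_const (indet k) * fps_X :: 'a ratfun fps)"
    for k
    unfolding q_factor_def by (rule dvd_div_mult_self, rule fps_unit_dvd, rule unit)
  have "schur_kernel indet i j * (indet j + indet i) = (indet j - indet i :: 'a ratfun)"
    using indet_add_nonzero[of j i, where 'a = 'a] by (simp add: schur_kernel_def)
  then have "fps_const (schur_kernel indet i j * (indet j + indet i)) = fps_const (indet j - indet i :: 'a ratfun)"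
    by (rule arg_cong)
  then have A: "kernel_fps i j * (?b + ?a) = ?b - ?a"
    by (simp add: kernel_fps_def)
  have regroup: "D * E * (A * c) + c * (D * (h * E) - E * (g * D)) = D * E * c * (A + h - g)"
    for D E c A g h :: "'a ratfun fps"
    by (simp add: algebra_simps)
  let ?P = "?Di * ?Dj * (?b + ?a)"
  have "?P * (q_factor i * q_factor j * kernel_fps i j)
     = (q_factor i * ?Di) * (q_factor j * ?Dj) * (kernel_fps i j * (?b + ?a))"
    by (simp only: mult_ac)
  also have "\<dots> = ?Ni * ?Nj * (?b - ?a)" by (simp only: gD A)
  also have "\<dots> = (?Di * ?Dj) * (?b - ?a) + (?b + ?a) * (?Di * ?Nj - ?Dj * ?Ni)"
    by (simp only: ring_distribs mult_ac mult_1_left mult_1_right) (simp only: algebra_simps)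
  also have "\<dots> = (?Di * ?Dj) * (kernel_fps i j * (?b + ?a))
      + (?b + ?a) * (?Di * (q_factor j * ?Dj) - ?Dj * (q_factor i * ?Di))"
    by (simp only: gD A)
  also have "\<dots> = ?P * (kernel_fps i j + q_factor j - q_factor i)"
    by (rule regroup)
  finally have eq: "?P * (q_factor i * q_factor j * kernel_fps i j)
     = ?P * (kernel_fps i j + q_factor j - q_factor i)" .
  have "?Di \<noteq> 0" "?Dj \<noteq> 0" using unit fps_nonzero_nth by blast+
  moreover have "?b + ?a \<noteq> 0" using indet_add_nonzero[of j i, where 'a = 'a] by simp
  ultimately have "?P \<noteq> 0" by simp
  with eq show ?thesis by simp
qed

lemma schur_q_eq: "schur_q n r = fps_nth (\<Prod>i<n. q_factor i) r"
  by (simp add: schur_q_def q_factor_def)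

lemma q_factor_column_truncate:
  fixes f :: "nat \<Rightarrow> 'a::field_char_0 poly"
  assumes adm: "admissible f" and S: "s + r \<le> S"
  shows "agree r (q_factor i * column f s i) (\<Sum>t\<le>S. lift_fps (pieri_b f s t) * column f t i)"
  unfolding agree_def
proof (intro allI impI)
  fix k assume k: "k \<le> r"
  have "fps_nth (q_factor i * column f s i) k = poly (map_poly const (times_q (f s) k)) (indet i)"
    unfolding poly_lift_times_q q_factor_def column_def fps_mult_right_const_nth geometric_quotient_nth ..
  also have "\<dots> = poly (map_poly const (\<Sum>t\<le>S. smult (fps_nth (pieri_b f s t) k) (f t))) (indet i)"
    by (subst pieri_b_expansion[OF adm]) (use k S in simp_all)
  also have "\<dots> = fps_nth (\<Sum>t\<le>S. lift_fps (pieri_b f s t) * column f t i) k"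
    unfolding poly_lift_sum column_def fps_sum_nth fps_mult_right_const_nth lift_fps_nth ..
  finally show "fps_nth (q_factor i * column f s i) k
     = fps_nth (\<Sum>t\<le>S. lift_fps (pieri_b f s t) * column f t i) k" .
qed

lemma permute_list_append:
  assumes p: "p permutes {..<length xs}"
  shows "permute_list p (xs @ ys) = permute_list p xs @ ys"
proof (rule nth_equalityI)
  fix i assume i: "i < length (permute_list p (xs @ ys))"
  have p': "p permutes {..<length (xs @ ys)}" by (rule permutes_subset[OF p]) auto
  have "p i < length xs" if "i < length xs" using permutes_in_image[OF p, of i] that by simp
  moreover have "p i = i" if "\<not> i < length xs" using permutes_not_in[OF p, of i] that by simp
  ultimately show "permute_list p (xs @ ys) ! i = (permute_list p xs @ ys) ! i"
    using permute_list_nth[OF p'] permute_list_nth[OF p] i by (cases "i < length xs") (simp_all add: nth_append)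
qed simp

text \<open>
  The columns \<open>\<beta>\<close> carry the factors \<open>g(x_i)\<close>, the columns \<open>\<gamma>\<close> do not; the latter are needed for the
  column \<open>1\<close> that \<open>bordered_pf_perturb\<close> adds. The bound \<open>S\<close> cuts off the expansion where it does not
  influence the coefficient of \<open>z^r\<close>.
\<close>

lemma q_columns_expand:
  fixes f :: "nat \<Rightarrow> 'a::field_char_0 poly"
  assumes adm: "admissible f" and ev: "even (n + length \<beta> + length \<gamma>)"
    and S: "\<And>s. s \<in> set \<beta> \<Longrightarrow> s + r \<le> S"
  shows "fps_nth (bordered_pf n kernel_fps (map (\<lambda>s i. q_factor i * column f s i) \<beta> @ map (column f) \<gamma>)) r
     = (\<Sum>xs | set xs \<subseteq> {..S} \<and> length xs = length \<beta> \<and> sorted_wrt (>) xs.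
          const (fps_nth (det (B_mat f xs \<beta>)) r) * nimmo (lift_seq f) indet n (xs @ \<gamma>))"
proof -
  define bs where "bs = map (\<lambda>s t. lift_fps (pieri_b f s t)) \<beta>"
  define F where "F xs = bordered_pf n kernel_fps (map (column f) xs @ map (column f) \<gamma>)" for xs
  let ?k = "length \<beta>"
  let ?D = "{xs. set xs \<subseteq> {..S} \<and> length xs = ?k \<and> sorted_wrt (>) xs}"
  have F: "F xs = fps_const (nimmo (lift_seq f) indet n (xs @ \<gamma>))" for xs
    unfolding F_def map_append[symmetric] by (rule bordered_pf_columns)
  have "agree r (bordered_pf n kernel_fps (map (\<lambda>s i. q_factor i * column f s i) \<beta> @ map (column f) \<gamma>))
     (bordered_pf n kernel_fps (map (\<lambda>b i. \<Sum>t\<le>S. b t * column f t i) bs @ map (column f) \<gamma>))"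
    unfolding bordered_pf_def bs_def length_append length_map
  proof (rule agree_pf)
    fix i j assume ij: "i < j" "j < n + (length \<beta> + length \<gamma>)"
    have "agree r (q_factor i * column f (\<beta> ! (j - n)) i)
        (\<Sum>t\<le>S. lift_fps (pieri_b f (\<beta> ! (j - n)) t) * column f t i)" if "n \<le> j" "j - n < length \<beta>"
      by (rule q_factor_column_truncate[OF adm]) (rule S, use that in simp)
    then show "agree r
       (bordered n kernel_fps (map (\<lambda>s i. q_factor i * column f s i) \<beta> @ map (column f) \<gamma>) i j)
       (bordered n kernel_fps (map (\<lambda>b i. \<Sum>t\<le>S. b t * column f t i)
          (map (\<lambda>s t. lift_fps (pieri_b f s t)) \<beta>) @ map (column f) \<gamma>) i j)"
      using ij by (auto simp: bordered_def nth_append agree_refl)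
  qed
  then have "fps_nth (bordered_pf n kernel_fps (map (\<lambda>s i. q_factor i * column f s i) \<beta> @ map (column f) \<gamma>)) r
     = fps_nth (bordered_pf n kernel_fps (map (\<lambda>b i. \<Sum>t\<le>S. b t * column f t i) bs @ map (column f) \<gamma>)) r"
    by (simp add: agree_def)
  also have "bordered_pf n kernel_fps (map (\<lambda>b i. \<Sum>t\<le>S. b t * column f t i) bs @ map (column f) \<gamma>)
     = (\<Sum>xs | set xs \<subseteq> {..S} \<and> length xs = ?k. (\<Prod>j<?k. (bs ! j) (xs ! j)) * F xs)"
    using bordered_pf_expand_columns[of "{..S}" n "[]" bs "map (column f) \<gamma>" kernel_fps "column f"] ev
    by (simp add: bs_def F_def)
  also have "\<dots> = (\<Sum>xs\<in>?D. det (mat ?k ?k (\<lambda>(i,j). (bs ! j) (xs ! i))) * F xs)"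
  proof (rule sum_lists_eq_sum_det)
    show "length bs = ?k" by (simp add: bs_def)
    fix xs :: "nat list" assume len: "length xs = ?k"
    have ev': "even (n + length (map (column f) (xs @ \<gamma>)))" using ev len by (simp add: add.assoc)
    show "F (permute_list p xs) = of_int (sign p) * F xs" if p: "p permutes {..<?k}" for p
    proof -
      have p': "p permutes {..<length (map (column f) (xs @ \<gamma>))}"
        by (rule permutes_subset[OF p]) (use len in auto)
      have p'': "p permutes {..<length xs}" using p len by simp
      show ?thesis
        using bordered_pf_permute_columns[OF kernel_fps_alternating ev' p']
          permute_list_append[of p "map (column f) xs" "map (column f) \<gamma>"]
          permute_list_map[OF p'', of "column f"] p''
        by (simp add: F_def)
    qed
    show "F xs = 0" if nd: "\<not> distinct xs"
    proof -
      obtain a b where "a < b" "b < length xs" "xs ! a = xs ! b"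
        using nd by (auto simp: distinct_conv_nth) (metis linorder_neqE_nat)
      then have "bordered_pf n kernel_fps (map (column f) (xs @ \<gamma>)) = 0"
        by (intro bordered_pf_repeated_column[OF two_nonzero kernel_fps_alternating ev', of a b])
          (auto simp: nth_append)
      then show ?thesis by (simp add: F_def)
    qed
  qed simp
  also have "\<dots> = (\<Sum>xs\<in>?D. lift_fps (det (B_mat f xs \<beta>)) * fps_const (nimmo (lift_seq f) indet n (xs @ \<gamma>)))"
  proof (rule sum.cong[OF refl])
    fix xs assume "xs \<in> ?D"
    then have "mat ?k ?k (\<lambda>(i,j). (bs ! j) (xs ! i)) = map_mat lift_fps (B_mat f xs \<beta>)"
      by (intro eq_matI) (auto simp: B_mat_def bs_def)
    then show "det (mat ?k ?k (\<lambda>(i,j). (bs ! j) (xs ! i))) * F xs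
      = lift_fps (det (B_mat f xs \<beta>)) * fps_const (nimmo (lift_seq f) indet n (xs @ \<gamma>))"
      by (simp add: comm_ring_hom.hom_det[OF lift_fps_hom] F)
  qed
  finally show ?thesis
    by (simp only: fps_sum_nth fps_mult_right_const_nth lift_fps_nth)
qed

lemma q_times_nimmo:
  fixes f :: "nat \<Rightarrow> 'a::field_char_0 poly"
  assumes adm: "admissible f" and ev: "even (n + length \<alpha>)"
  shows "(\<Prod>i<n. q_factor i) * fps_const (nimmo (lift_seq f) indet n \<alpha>)
     = bordered_pf n (\<lambda>i j. kernel_fps i j + q_factor j - q_factor i) (map (\<lambda>s i. q_factor i * column f s i) \<alpha>)"
proof -
  have "even (n + length (map (column f) \<alpha>))" using ev by simp
  from bordered_pf_scale[OF this, of q_factor kernel_fps]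
  show ?thesis by (simp add: bordered_pf_columns q_factor_kernel comp_def)
qed

lemma column_0: "admissible f \<Longrightarrow> column f 0 = (\<lambda>_. 1)"
proof -
  assume "admissible f"
  then have "map_poly const (f 0) = 1"
    by (intro poly_eqI) (auto simp: admissible_def coeff_map_poly const_0 const_1 coeff_1)
  then show ?thesis by (simp add: column_def fun_eq_iff)
qed

text \<open>
  A strictly decreasing list either has only positive entries, or ends with its only \<open>0\<close>. The
  hypothesis on \<open>H\<close> allows the restriction to partitions of length at most \<open>n\<close> on the
  right.
\<close>

lemma sum_decreasing_lists_split:
  fixes H :: "nat list \<Rightarrow> 'b::comm_monoid_add"
  assumes big: "\<And>xs. length xs = k \<Longrightarrow> n < k \<Longrightarrow> H xs = 0"
  shows "(\<Sum>xs | set xs \<subseteq> {..S} \<and> length xs = k \<and> sorted_wrt (>) xs. H xs)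
     = (\<Sum>l | strict_partition l \<and> length l \<le> n \<and> set l \<subseteq> {..S}.
          (if length l = k then H l else 0) + (if length l + 1 = k then H (l\<^sup>0) else 0))"
    (is "sum H ?D = sum ?h ?P")
proof (cases "n < k")
  case True
  then have "sum H ?D = 0" by (intro sum.neutral) (auto simp: big)
  moreover have "sum ?h ?P = 0" by (intro sum.neutral) (use True in \<open>auto simp: big append_zero_def\<close>)
  ultimately show ?thesis by simp
next
  case False
  have finP: "finite ?P"
    by (rule finite_subset[OF _ finite_lists_length_le[of "{..S}" n]]) auto
  let ?P1 = "{l \<in> ?P. length l = k}" and ?P2 = "{l \<in> ?P. length l + 1 = k}"
  have D: "?D = ?P1 \<union> append_zero ` ?P2"
  proof (intro equalityI subsetI)
    fix xs assume xs: "xs \<in> ?D"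
    show "xs \<in> ?P1 \<union> append_zero ` ?P2"
    proof (cases "0 \<in> set xs")
      case True
      then obtain l y where ly: "xs = l @ [y]" by (cases xs rule: rev_cases) auto
      have "y = 0" using True xs ly by (auto simp: sorted_wrt_append)
      then have "xs = l\<^sup>0" using ly by (simp add: append_zero_def)
      moreover have "l \<in> ?P2" using xs ly \<open>y = 0\<close> False
        by (auto simp: sorted_wrt_append strict_partition_def)
      ultimately show ?thesis by blast
    next
      case False
      then show ?thesis using xs \<open>\<not> n < k\<close> by (simp add: strict_partition_def)
    qed
  next
    fix xs assume "xs \<in> ?P1 \<union> append_zero ` ?P2"
    then show "xs \<in> ?D"
      by (auto simp: strict_partition_def append_zero_def sorted_wrt_append intro: gr0I)
  qed
  have inj: "inj_on append_zero ?P2" by (rule inj_onI) (simp add: append_zero_def)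
  have disj: "?P1 \<inter> append_zero ` ?P2 = {}"
  proof (rule equals0I)
    fix x assume "x \<in> ?P1 \<inter> append_zero ` ?P2"
    then have x: "strict_partition x" and "\<exists>l. x = append_zero l" by blast+
    then obtain l where "x = append_zero l" by blast
    then have "0 \<in> set x" by (simp add: append_zero_def)
    with x show False by (simp add: strict_partition_def)
  qed
  have "sum H ?D = sum H ?P1 + sum H (append_zero ` ?P2)"
  proof -
    have "finite ?P1" "finite ?P2" by (rule finite_subset[OF _ finP], blast)+
    then show ?thesis unfolding D by (intro sum.union_disjoint disj finite_imageI)
  qed
  also have "sum H (append_zero ` ?P2) = (\<Sum>l\<in>?P2. H (l\<^sup>0))" by (simp only: sum.reindex[OF inj] comp_def)
  also have "sum H ?P1 + (\<Sum>l\<in>?P2. H (l\<^sup>0)) = sum ?h ?P"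
    unfolding sum.distrib sum.inter_filter[OF finP] ..
  finally show ?thesis .
qed

definition pieri_det :: "(nat \<Rightarrow> 'a::field_char_0 poly) \<Rightarrow> nat \<Rightarrow> nat list \<Rightarrow> nat list \<Rightarrow> 'a fps" where
  "pieri_det f n lam \<mu> =
    (if even (n + length \<mu>) \<and> length lam = length \<mu> then det (B_mat f lam \<mu>)
     else if even (n + length \<mu>) \<and> length lam + 1 = length \<mu> then det (B_mat f (lam\<^sup>0) \<mu>)
     else if even (n + length \<mu>) \<and> length lam = length \<mu> + 1 then det (B_mat f lam (\<mu>\<^sup>0))
     else if odd (n + length \<mu>) \<and> length lam = length \<mu> then det (B_mat f (lam\<^sup>0) (\<mu>\<^sup>0))
     else if odd (n + length \<mu>) \<and> length lam = length \<mu> + 1 then det (B_mat f lam (\<mu>\<^sup>0))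
     else 0)"

lemma nimmo_too_many:
  assumes "even (n + length \<alpha>)" "n < length \<alpha>"
  shows "nimmo f a n \<alpha> = 0"
  unfolding nimmo_def by (rule bordered_pf_too_many_columns) (use assms in simp_all)

lemma nimmo_double_zero:
  "even (n + length l) \<Longrightarrow> nimmo (lift_seq f) indet n ((l\<^sup>0) @ [0]) = 0"
proof -
  assume "even (n + length l)"
  then have ev: "even (n + length (map (column f) ((l\<^sup>0) @ [0])))" by (simp add: append_zero_def)
  have "bordered_pf n kernel_fps (map (column f) ((l\<^sup>0) @ [0])) = 0"
    by (rule bordered_pf_repeated_column[OF two_nonzero kernel_fps_alternating ev,
        of "length l" "Suc (length l)"])
      (simp_all add: append_zero_def nth_append)
  then show ?thesis unfolding bordered_pf_columns by simp
qed

text \<open>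
  The product is expanded as described at the beginning. In the even case the list of length
  \<open>l(\<mu>)\<close> contributes \<open>\<lambda>\<close> and \<open>\<lambda>\<^sup>0\<close>, and the list of length \<open>l(\<mu>) + 1\<close>, to which the column of \<open>f_0\<close> is
  appended, contributes \<open>\<lambda>\<close> as \<open>\<lambda>\<^sup>0\<close>. In each case the resulting sequence is the padding of
  \<open>\<lambda>\<close>.
\<close>

lemma nimmo_times_schur_q:
  fixes f :: "nat \<Rightarrow> 'a::field_char_0 poly"
  assumes adm: "admissible f" and len: "length \<mu> \<le> n" and S: "r + sum_list \<mu> \<le> S"
  shows "nimmo (lift_seq f) indet n (pad n \<mu>) * schur_q n r
     = (\<Sum>l | strict_partition l \<and> length l \<le> n \<and> set l \<subseteq> {..S}.
          const (fps_nth (pieri_det f n l \<mu>) r) * nimmo (lift_seq f) indet n (pad n l))"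
proof -
  let ?W = "map (\<lambda>s i. q_factor i * column f s i)"
  let ?A' = "\<lambda>i j. kernel_fps i j + q_factor j - q_factor i"
  let ?N = "nimmo (lift_seq f) indet n"
  let ?P = "{l. strict_partition l \<and> length l \<le> n \<and> set l \<subseteq> {..S}}"
  have W0: "(\<lambda>i. q_factor i * column f 0 i) = q_factor" by (simp add: column_0[OF adm])
  have S0: "s + r \<le> S" if "s \<in> set (\<mu>\<^sup>0)" for s
    using that S member_le_sum_list[of s \<mu>] by (auto simp: append_zero_def)
  have S1: "s + r \<le> S" if "s \<in> set \<mu>" for s
    using that S0 by (simp add: append_zero_def)
  have "?N (pad n \<mu>) * schur_q n r = fps_nth ((\<Prod>i<n. q_factor i) * fps_const (?N (pad n \<mu>))) r"
    by (simp add: schur_q_eq mult.commute)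
  also have "\<dots> = fps_nth (bordered_pf n ?A' (?W (pad n \<mu>))) r"
    by (simp add: q_times_nimmo[OF adm pad_even])
  also have "\<dots> = (\<Sum>l\<in>?P. const (fps_nth (pieri_det f n l \<mu>) r) * ?N (pad n l))"
  proof (cases "even (n + length \<mu>)")
    case True
    have ev: "even (n + length (?W \<mu>))" using True by simp
    have two_parts: "bordered_pf n ?A' (?W (pad n \<mu>)) = bordered_pf n kernel_fps (?W \<mu> @ map (column f) [])
       + bordered_pf n kernel_fps (?W (\<mu>\<^sup>0) @ map (column f) [0])"
      using bordered_pf_perturb[OF two_nonzero kernel_fps_alternating ev, of q_factor] True
      by (simp add: pad_def append_zero_def W0 column_0[OF adm])
    have 1: "fps_nth (bordered_pf n kernel_fps (?W \<mu> @ map (column f) [])) r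
      = (\<Sum>l\<in>?P. (if length l = length \<mu> then const (fps_nth (det (B_mat f l \<mu>)) r) * ?N (l @ []) else 0)
          + (if length l + 1 = length \<mu> then const (fps_nth (det (B_mat f (l\<^sup>0) \<mu>)) r) * ?N (l\<^sup>0 @ []) else 0))"
      by (subst q_columns_expand[OF adm _ S1], use True in simp, assumption,
          rule sum_decreasing_lists_split) (use len in simp)
    have 2: "fps_nth (bordered_pf n kernel_fps (?W (\<mu>\<^sup>0) @ map (column f) [0])) r
      = (\<Sum>l\<in>?P. (if length l = length (\<mu>\<^sup>0) then const (fps_nth (det (B_mat f l (\<mu>\<^sup>0))) r) * ?N (l @ [0]) else 0)
          + (if length l + 1 = length (\<mu>\<^sup>0) then const (fps_nth (det (B_mat f (l\<^sup>0) (\<mu>\<^sup>0))) r) * ?N (l\<^sup>0 @ [0]) else 0))"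
      by (subst q_columns_expand[OF adm _ S0], use True in \<open>simp add: append_zero_def\<close>, assumption,
          rule sum_decreasing_lists_split)
        (use True in \<open>simp add: append_zero_def nimmo_too_many\<close>)
    show ?thesis
      unfolding two_parts fps_add_nth 1 2 sum.distrib[symmetric]
    proof (rule sum.cong[OF refl])
      fix l assume "l \<in> ?P"
      consider "length l = length \<mu>" | "length l + 1 = length \<mu>" | "length l = length \<mu> + 1"
        | "length l \<noteq> length \<mu>" "length l + 1 \<noteq> length \<mu>" "length l \<noteq> length \<mu> + 1" by blast
      then show "(if length l = length \<mu> then const (fps_nth (det (B_mat f l \<mu>)) r) * ?N (l @ []) else 0)
          + (if length l + 1 = length \<mu> then const (fps_nth (det (B_mat f (l\<^sup>0) \<mu>)) r) * ?N (l\<^sup>0 @ []) else 0)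
          + ((if length l = length (\<mu>\<^sup>0) then const (fps_nth (det (B_mat f l (\<mu>\<^sup>0))) r) * ?N (l @ [0]) else 0)
          + (if length l + 1 = length (\<mu>\<^sup>0) then const (fps_nth (det (B_mat f (l\<^sup>0) (\<mu>\<^sup>0))) r) * ?N (l\<^sup>0 @ [0]) else 0))
          = const (fps_nth (pieri_det f n l \<mu>) r) * ?N (pad n l)"
      proof cases
        case 1
        then have "?N (l\<^sup>0 @ [0]) = 0" using True by (intro nimmo_double_zero) simp
        then show ?thesis using 1 True by (simp add: pieri_det_def pad_def append_zero_def)
      next
        case 2
        then have "odd (n + length l)" using True by presburger
        then have "pad n l = l\<^sup>0" by (simp add: pad_def)
        then show ?thesis using 2 True by (auto simp: pieri_det_def append_zero_def)
      next
        case 3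
        then show ?thesis using True by (simp add: pieri_det_def pad_def append_zero_def)
      next
        case 4
        then show ?thesis using True by (simp add: pieri_det_def append_zero_def const_0)
      qed
    qed
  next
    case False
    have ev: "odd (n + length (?W \<mu>))" using False by simp
    have one_part: "bordered_pf n ?A' (?W (pad n \<mu>)) = bordered_pf n kernel_fps (?W (\<mu>\<^sup>0) @ map (column f) [])"
      using bordered_pf_perturb_with_column[OF two_nonzero kernel_fps_alternating ev, of q_factor] False
      by (simp add: pad_def append_zero_def W0)
    have 1: "fps_nth (bordered_pf n kernel_fps (?W (\<mu>\<^sup>0) @ map (column f) [])) r
      = (\<Sum>l\<in>?P. (if length l = length (\<mu>\<^sup>0) then const (fps_nth (det (B_mat f l (\<mu>\<^sup>0))) r) * ?N (l @ []) else 0)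
          + (if length l + 1 = length (\<mu>\<^sup>0) then const (fps_nth (det (B_mat f (l\<^sup>0) (\<mu>\<^sup>0))) r) * ?N (l\<^sup>0 @ []) else 0))"
      by (subst q_columns_expand[OF adm _ S0], use False in \<open>simp add: append_zero_def\<close>, assumption,
          rule sum_decreasing_lists_split)
        (use False in \<open>simp add: append_zero_def nimmo_too_many\<close>)
    show ?thesis
      unfolding one_part 1
    proof (rule sum.cong[OF refl])
      fix l assume "l \<in> ?P"
      consider "length l = length \<mu>" | "length l = length \<mu> + 1"
        | "length l \<noteq> length \<mu>" "length l \<noteq> length \<mu> + 1" by blast
      then show "(if length l = length (\<mu>\<^sup>0) then const (fps_nth (det (B_mat f l (\<mu>\<^sup>0))) r) * ?N (l @ []) else 0)
          + (if length l + 1 = length (\<mu>\<^sup>0) then const (fps_nth (det (B_mat f (l\<^sup>0) (\<mu>\<^sup>0))) r) * ?N (l\<^sup>0 @ []) else 0)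
          = const (fps_nth (pieri_det f n l \<mu>) r) * ?N (pad n l)"
      proof cases
        case 1
        then show ?thesis using False by (simp add: pieri_det_def pad_def append_zero_def)
      next
        case 2
        then show ?thesis using False by (simp add: pieri_det_def pad_def append_zero_def)
      next
        case 3
        then show ?thesis using False by (simp add: pieri_det_def append_zero_def const_0)
      qed
    qed
  qed
  finally show ?thesis .
qed

theorem theorem5p3:
  fixes f :: "nat \<Rightarrow> 'a::field_char_0 poly" and n :: nat and lam \<mu> :: "nat list"
  assumes "admissible f"
    and "strict_partition \<mu>" and "length \<mu> \<le> n"
    and "strict_partition lam" and "length lam \<le> n"
  shows "Abs_fps (\<lambda>r. pieri_coeff f n lam \<mu> r) =
    (if even (n + length \<mu>) \<and> length lam = length \<mu> then det (B_mat f lam \<mu>)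
     else if even (n + length \<mu>) \<and> length lam + 1 = length \<mu> then det (B_mat f (lam\<^sup>0) \<mu>)
     else if even (n + length \<mu>) \<and> length lam = length \<mu> + 1 then det (B_mat f lam (\<mu>\<^sup>0))
     else if odd (n + length \<mu>) \<and> length lam = length \<mu> then det (B_mat f (lam\<^sup>0) (\<mu>\<^sup>0))
     else if odd (n + length \<mu>) \<and> length lam = length \<mu> + 1 then det (B_mat f lam (\<mu>\<^sup>0))
     else 0)"
proof -
  have "pieri_coeff f n lam \<mu> r = fps_nth (pieri_det f n lam \<mu>) r" for r
  proof -
    \<comment> \<open>The summand \<open>sum_list lam\<close> ensures that \<open>lam\<close> itself is below the cut-off.\<close>
    define S where "S = r + sum_list \<mu> + sum_list lam"
    define P where "P = {l. strict_partition l \<and> length l \<le> n \<and> set l \<subseteq> {..S}}"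
    define c where "c l = (if l \<in> P then fps_nth (pieri_det f n l \<mu>) r else 0)" for l
    have finP: "finite P" unfolding P_def
      by (rule finite_subset[OF _ finite_lists_length_le[of "{..S}" n]]) auto
    have sub: "{l. c l \<noteq> 0} \<subseteq> P" by (auto simp: c_def)
    have "gen_P f n \<mu> * schur_q n r = (nimmo (lift_seq f) indet n (pad n \<mu>) * schur_q n r) / Delta n"
      by (simp add: gen_P_eq_nimmo)
    also have "\<dots> = (\<Sum>l\<in>P. const (fps_nth (pieri_det f n l \<mu>) r) * nimmo (lift_seq f) indet n (pad n l)) / Delta n"
    proof -
      have "r + sum_list \<mu> \<le> S" by (simp add: S_def)
      from nimmo_times_schur_q[OF assms(1,3) this] show ?thesis by (simp only: P_def)
    qed
    also have "\<dots> = (\<Sum>l\<in>P. const (c l) * gen_P f n l)"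
      by (simp add: sum_divide_distrib gen_P_eq_nimmo c_def)
    also have "\<dots> = (\<Sum>l | c l \<noteq> 0. const (c l) * gen_P f n l)"
      by (rule sum.mono_neutral_right[OF finP sub]) (auto simp: const_0)
    finally have "P_coeff f n (gen_P f n \<mu> * schur_q n r) = c"
      using finite_subset[OF sub finP] sub
      by (intro P_coeff_unique[OF assms(1)]) (auto simp: P_def)
    moreover have "lam \<in> P"
      using assms(4,5) member_le_sum_list[of _ lam] by (fastforce simp: P_def S_def)
    ultimately show ?thesis by (simp add: pieri_coeff_def c_def)
  qed
  then show ?thesis unfolding pieri_det_def[symmetric] by (simp add: fps_eq_iff)
qed

end
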